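(* Let $q$ be a prime power, $\lambda$ a nontrivial additive character of $\mathbb{F}_q$, and $x,y\in\mathbb{F}_q^*$. Then, as formal power series in $u$, \[ 1+\sum_{n=1}^{\infty}\frac{u^n}{|GL(n,q)|}\sum_{g\in GL(n,q)}\lambda\big(x\operatorname{tr}(g)+y\operatorname{tr}(g^{-1})\big) = \prod_{i\ge 1}\left(1+\frac{u\,K_\lambda(x,y)}{q^i}+\frac{q\,u^2}{q^{2i}}\right). \]
   Context: $GL(n,q)$ is the group of invertible $n\times n$ matrices over $\mathbb{F}_q$, and $K_\lambda(x,y)=\sum_{\alpha\in\mathbb{F}_q^*}\lambda(x\alpha+y/\alpha)$. *)

theory Defs
  imports Complex_Main "HOL-Computational_Algebra.Formal_Power_Series" "Jordan_Normal_Form.Matrix"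
begin

definition add_char :: "('a::field \<Rightarrow> complex) \<Rightarrow> bool" where
  "add_char lam \<longleftrightarrow> (\<forall>a b. lam (a + b) = lam a * lam b) \<and> (\<forall>a. lam a \<noteq> 0)"

definition nontrivial_char :: "('a::field \<Rightarrow> complex) \<Rightarrow> bool" where
  "nontrivial_char lam \<longleftrightarrow> (\<exists>a. lam a \<noteq> 1)"

definition GL :: "nat \<Rightarrow> 'a::field mat set" where
  "GL n = {A \<in> carrier_mat n n. invertible_mat A}"

definition mat_trace :: "'a::comm_ring_1 mat \<Rightarrow> 'a" where
  "mat_trace A = (\<Sum>i<dim_row A. A $$ (i, i))"

definition mat_inv :: "'a::field mat \<Rightarrow> 'a mat" where
  "mat_inv A = (SOME B. B \<in> carrier_mat (dim_row A) (dim_row A) \<and>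
                        A * B = 1\<^sub>m (dim_row A) \<and> B * A = 1\<^sub>m (dim_row A))"

definition kloosterman :: "('a::{finite,field} \<Rightarrow> complex) \<Rightarrow> 'a \<Rightarrow> 'a \<Rightarrow> complex" where
  "kloosterman lam x y = (\<Sum>\<alpha>\<in>UNIV - {0}. lam (x * \<alpha> + y / \<alpha>))"

definition GL_char_fps :: "('a::{finite,field} \<Rightarrow> complex) \<Rightarrow> 'a \<Rightarrow> 'a \<Rightarrow> complex fps" where
  "GL_char_fps lam x y = Abs_fps (\<lambda>n. if n = 0 then 1 else
      (1 / of_nat (card (GL n :: 'a mat set))) *
      (\<Sum>g\<in>GL n. lam (x * mat_trace g + y * mat_trace (mat_inv g))))"

definition GL_factor :: "('a::{finite,field} \<Rightarrow> complex) \<Rightarrow> 'a \<Rightarrow> 'a \<Rightarrow> nat \<Rightarrow> complex fps" where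
  "GL_factor lam x y i = 1 + fps_const (kloosterman lam x y / (of_nat (card (UNIV :: 'a set))) ^ i) * fps_X
      + fps_const ((of_nat (card (UNIV :: 'a set))) / (of_nat (card (UNIV :: 'a set))) ^ (2 * i)) * fps_X ^ 2"

end

theory Submission
  imports Defs "Jordan_Normal_Form.Determinant" "Jordan_Normal_Form.Column_Operations"
begin

text \<open>
  Write \<open>K\<^sub>n\<close> for the sum over \<open>GL n\<close> and split it according to the first column \<open>g e\<^sub>0\<close>.
  The \<open>g\<close> having \<open>e\<^sub>0\<close> as an eigenvector are block triangular and contribute \<open>q\<^sup>n\<^sup>-\<^sup>1 K\<^sub>1 K\<^sub>n\<^sub>-\<^sub>1\<close>.
  Otherwise conjugation reduces to \<open>g e\<^sub>0 = e\<^sub>1\<close>. Averaging over the transvections \<open>g \<mapsto> g (1 + t E\<^sub>0\<^sub>j)\<close>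
  kills all \<open>g\<close> except those preserving the span of \<open>e\<^sub>0\<close> and \<open>e\<^sub>1\<close> and acting on it as
  \<open>e\<^sub>0 \<mapsto> e\<^sub>1\<close>, \<open>e\<^sub>1 \<mapsto> (y / x) (e\<^sub>0 - c e\<^sub>1)\<close>, where the two trace terms cancel. With the same splitting of
  the order of \<open>GL n\<close>, the coefficients \<open>a\<^sub>n = K\<^sub>n / card (GL n)\<close> satisfy
  \<open>(q\<^sup>n - 1) a\<^sub>n = K\<^sub>1 a\<^sub>n\<^sub>-\<^sub>1 + q a\<^sub>n\<^sub>-\<^sub>2\<close>, which is the functional equation
  \<open>P(q u) = (1 + K\<^sub>1 u + q u\<^sup>2) P(u)\<close> of the infinite product.
\<close>

section \<open>Pairs of mutually inverse matrices\<close>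

text \<open>Carrying the inverse as a second component avoids the choice in \<open>mat_inv\<close>:
  products, conjugations and block decompositions can then be written down for \<open>g\<close> and
  its inverse at once.\<close>

definition inv_pairs :: "nat \<Rightarrow> ('a::field mat \<times> 'a mat) set" where
  "inv_pairs n = {(g, h). g \<in> carrier_mat n n \<and> h \<in> carrier_mat n n \<and> g * h = 1\<^sub>m n \<and> h * g = 1\<^sub>m n}"

lemma inv_pairsI:
  "g \<in> carrier_mat n n \<Longrightarrow> h \<in> carrier_mat n n \<Longrightarrow> g * h = 1\<^sub>m n \<Longrightarrow> (g, h) \<in> inv_pairs n"
  using mat_mult_left_right_inverse by (auto simp: inv_pairs_def)

lemma inv_pairsD:
  assumes "(g, h) \<in> inv_pairs n"
  shows "g \<in> carrier_mat n n" "h \<in> carrier_mat n n" "g * h = 1\<^sub>m n" "h * g = 1\<^sub>m n"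
  using assms by (auto simp: inv_pairs_def)

lemma inv_pairs_inverse_unique:
  assumes "(g, h) \<in> inv_pairs n" and "(g, h') \<in> inv_pairs n"
  shows "h = h'"
proof -
  note 1 = inv_pairsD[OF assms(1)] and 2 = inv_pairsD[OF assms(2)]
  have "h = h * (g * h')" using 1 2 by simp
  also have "\<dots> = (h * g) * h'" by (rule assoc_mult_mat[OF 1(2,1) 2(2), symmetric])
  also have "\<dots> = h'" using 1 left_mult_one_mat[OF 2(2)] by simp
  finally show ?thesis .
qed

lemma inv_pairs_swap: "(g, h) \<in> inv_pairs n \<longleftrightarrow> (h, g) \<in> inv_pairs n"
  by (auto simp: inv_pairs_def)

lemma inv_pairs_cancel:
  assumes "(g, h) \<in> inv_pairs n" and "a \<in> carrier_mat n n"
  shows "g * (h * a) = a" "h * (g * a) = a" "a * g * h = a" "a * h * g = a"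
proof -
  note d = inv_pairsD[OF assms(1)] assms(2)
  show "g * (h * a) = a" using assoc_mult_mat[OF d(1,2,5)] d by simp
  show "h * (g * a) = a" using assoc_mult_mat[OF d(2,1,5)] d by simp
  show "a * g * h = a" using assoc_mult_mat[OF d(5,1,2)] d by simp
  show "a * h * g = a" using assoc_mult_mat[OF d(5,2,1)] d by simp
qed

lemma inv_pairs_mult:
  assumes "(g, h) \<in> inv_pairs n" and "(g', h') \<in> inv_pairs n"
  shows "(g * g', h' * h) \<in> inv_pairs n"
proof (rule inv_pairsI)
  note 1 = inv_pairsD[OF assms(1)] and 2 = inv_pairsD[OF assms(2)]
  show "g * g' \<in> carrier_mat n n" "h' * h \<in> carrier_mat n n" using 1 2 by auto
  have "(g * g') * (h' * h) = g * (g' * (h' * h))"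
    using 1 2 by (simp add: assoc_mult_mat[of _ n n _ n _ n])
  also have "\<dots> = 1\<^sub>m n" using 1 2 by (simp add: inv_pairs_cancel[OF assms(2)])
  finally show "(g * g') * (h' * h) = 1\<^sub>m n" .
qed

section \<open>Counting matrices and vectors over a finite field\<close>

lemma bij_betw_carrier_mat:
  "bij_betw (\<lambda>f. mat nr nc f) (PiE ({..<nr} \<times> {..<nc}) (\<lambda>_. UNIV)) (carrier_mat nr nc :: 'a mat set)"
proof (rule bij_betwI[where g = "\<lambda>A. restrict (\<lambda>p. A $$ p) ({..<nr} \<times> {..<nc})"])
  show "restrict (\<lambda>p. mat nr nc f $$ p) ({..<nr} \<times> {..<nc}) = f"
    if "f \<in> PiE ({..<nr} \<times> {..<nc}) (\<lambda>_. UNIV)" for f :: "_ \<Rightarrow> 'a"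
    using that by (auto simp: fun_eq_iff restrict_def PiE_def extensional_def)
qed auto

lemma finite_carrier_mat [simp]: "finite (carrier_mat nr nc :: 'a::finite mat set)"
  using bij_betw_finite[OF bij_betw_carrier_mat[of nr nc, where 'a = 'a]] by (simp add: finite_PiE)

lemma card_carrier_mat:
  "card (carrier_mat nr nc :: 'a::finite mat set) = card (UNIV :: 'a set) ^ (nr * nc)"
  using bij_betw_same_card[OF bij_betw_carrier_mat[of nr nc, where 'a = 'a]]
  by (simp add: card_PiE)

lemma bij_betw_carrier_vec:
  "bij_betw (\<lambda>f. vec n f) (PiE {..<n} (\<lambda>_. UNIV)) (carrier_vec n :: 'a vec set)"
proof (rule bij_betwI[where g = "\<lambda>v. restrict (\<lambda>i. v $ i) {..<n}"])
  show "restrict (\<lambda>i. vec n f $ i) {..<n} = f" if "f \<in> PiE {..<n} (\<lambda>_. UNIV)" for f :: "_ \<Rightarrow> 'a"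
    using that by (auto simp: fun_eq_iff restrict_def PiE_def extensional_def)
qed auto

lemma finite_carrier_vec [simp]: "finite (carrier_vec n :: 'a::finite vec set)"
  using bij_betw_finite[OF bij_betw_carrier_vec[of n, where 'a = 'a]] by (simp add: finite_PiE)

lemma card_carrier_vec: "card (carrier_vec n :: 'a::finite vec set) = card (UNIV :: 'a set) ^ n"
  using bij_betw_same_card[OF bij_betw_carrier_vec[of n, where 'a = 'a]] by (simp add: card_PiE)

lemma finite_inv_pairs [simp]: "finite (inv_pairs n :: ('a::{finite,field} mat \<times> 'a mat) set)"
  by (rule finite_subset[of _ "carrier_mat n n \<times> carrier_mat n n"]) (auto simp: inv_pairs_def)

section \<open>Passing from \<open>GL n\<close> to pairs\<close>

lemma inv_pairs_mat_inv:
  assumes "(g, h) \<in> inv_pairs n"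
  shows "mat_inv g = h"
proof -
  note d = inv_pairsD[OF assms]
  have dim: "dim_row g = n" using d by auto
  show ?thesis unfolding mat_inv_def dim
  proof (rule some_equality)
    show "h' = h" if "h' \<in> carrier_mat n n \<and> g * h' = 1\<^sub>m n \<and> h' * g = 1\<^sub>m n" for h'
      by (rule inv_pairs_inverse_unique[OF _ assms]) (use that d(1) in \<open>auto simp: inv_pairs_def\<close>)
  qed (use d in auto)
qed

lemma bij_betw_fst_inv_pairs: "bij_betw fst (inv_pairs n) (GL n)"
proof (rule bij_betw_imageI)
  show "inj_on fst (inv_pairs n :: ('a mat \<times> 'a mat) set)"
    by (auto simp: inj_on_def dest: inv_pairs_inverse_unique)
  have "\<exists>h. (g, h) \<in> inv_pairs n" if "g \<in> GL n" for g :: "'a mat"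
  proof -
    from that obtain h where g: "g \<in> carrier_mat n n"
      and 1: "g * h = 1\<^sub>m (dim_row g)" and 2: "h * g = 1\<^sub>m (dim_row h)"
      by (auto simp: GL_def invertible_mat_def inverts_mat_def)
    \<comment> \<open>Invertibility does not prescribe the shape of \<open>h\<close>; comparing the
      column counts in the two identities forces it to be n by n.\<close>
    have "dim_col h = n" using arg_cong[OF 1, of dim_col] g by simp
    moreover have "dim_row h = n" using arg_cong[OF 2, of dim_col] g by simp
    ultimately show ?thesis using g 1 by (intro exI[of _ h] inv_pairsI) auto
  qed
  then have "GL n \<subseteq> fst ` (inv_pairs n :: ('a mat \<times> 'a mat) set)"
    by (metis fst_conv imageI subsetI)
  moreover have "g \<in> GL n" if "(g, h) \<in> inv_pairs n" for g h :: "'a mat"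
  proof -
    note d = inv_pairsD[OF that]
    have "dim_row g = n" "dim_col g = n" "dim_row h = n" using d by auto
    then have "inverts_mat g h \<and> inverts_mat h g" "square_mat g"
      using d(3,4) by (auto simp: inverts_mat_def)
    then show ?thesis using d(1) unfolding GL_def invertible_mat_def by blast
  qed
  then have sub: "fst ` inv_pairs n \<subseteq> (GL n :: 'a mat set)" by (metis image_subsetI prod.collapse)
  moreover note sub
  ultimately show "fst ` inv_pairs n = (GL n :: 'a mat set)" by blast
qed

lemma card_GL_eq: "card (GL n :: 'a::field mat set) = card (inv_pairs n :: ('a mat \<times> 'a mat) set)"
  by (rule sym, rule bij_betw_same_card[OF bij_betw_fst_inv_pairs])

lemma sum_GL_eq:
  "(\<Sum>g\<in>GL n. F g (mat_inv g)) = (\<Sum>(g, h)\<in>inv_pairs n. F g h)"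
proof -
  have "(\<Sum>g\<in>GL n. F g (mat_inv g)) = (\<Sum>p\<in>inv_pairs n. F (fst p) (mat_inv (fst p)))"
    by (rule sum.reindex_bij_betw[OF bij_betw_fst_inv_pairs, symmetric])
  also have "\<dots> = (\<Sum>(g, h)\<in>inv_pairs n. F g h)"
    by (rule sum.cong) (auto simp: inv_pairs_mat_inv)
  finally show ?thesis .
qed

section \<open>Traces, and matrices with a prescribed column\<close>

lemma mat_trace_mult_commute:
  assumes "A \<in> carrier_mat n m" and "B \<in> carrier_mat m n"
  shows "mat_trace (A * B) = mat_trace (B * A)"
proof -
  have "mat_trace (A * B) = (\<Sum>i<n. \<Sum>j<m. A $$ (i, j) * B $$ (j, i))"
    using assms by (auto simp: mat_trace_def scalar_prod_def atLeast0LessThan intro!: sum.cong)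
  also have "\<dots> = (\<Sum>j<m. \<Sum>i<n. A $$ (i, j) * B $$ (j, i))" by (rule sum.swap)
  also have "\<dots> = mat_trace (B * A)"
    using assms by (auto simp: mat_trace_def scalar_prod_def atLeast0LessThan mult.commute intro!: sum.cong)
  finally show ?thesis .
qed

lemma mat_trace_four_block:
  assumes "A \<in> carrier_mat k k" and "D \<in> carrier_mat m m"
  shows "mat_trace (four_block_mat A B C D) = mat_trace A + mat_trace D"
proof -
  have "mat_trace (four_block_mat A B C D) = (\<Sum>i<k + m. if i < k then A $$ (i, i) else D $$ (i - k, i - k))"
    using assms by (auto simp: mat_trace_def intro!: sum.cong)
  also have "{..<k + m} = {..<k} \<union> (\<lambda>i. i + k) ` {..<m}"
  proof (intro equalityI subsetI)
    fix i assume "i \<in> {..<k + m}"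
    then show "i \<in> {..<k} \<union> (\<lambda>i. i + k) ` {..<m}"
      by (cases "i < k") (auto intro!: image_eqI[of _ _ "i - k"])
  qed auto
  also have "(\<Sum>i\<in>\<dots>. if i < k then A $$ (i, i) else D $$ (i - k, i - k))
      = (\<Sum>i<k. A $$ (i, i)) + (\<Sum>i<m. D $$ (i, i))"
    by (subst sum.union_disjoint) (auto simp: sum.reindex)
  finally show ?thesis using assms by (simp add: mat_trace_def)
qed

lemma mult_unit_vec_col:
  assumes "(A :: 'a::semiring_1 mat) \<in> carrier_mat nr n" and "j < n"
  shows "A *\<^sub>v unit_vec n j = col A j"
  using col_mult2[of A nr n "1\<^sub>m n" n j] assms right_mult_one_mat[OF assms(1)] by simp

text \<open>The identity with column \<open>j\<close> replaced by \<open>v\<close> is invertible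
  because \<open>v $ j\<close> is nonzero; swapping columns \<open>j\<close> and \<open>k\<close>
  then moves \<open>v\<close> into place. With \<open>k = 0\<close> this makes any nonzero vector
  the image of e_0; with \<open>k = 1\<close> and \<open>j > 1\<close> the last clause keeps e_0
  fixed, and likewise with \<open>j = 1\<close>.\<close>

lemma obtain_inv_pair_col:
  fixes v :: "'a::field vec"
  assumes v: "v \<in> carrier_vec n" and j: "j < n" "v $ j \<noteq> 0" and k: "k < n"
  obtains B B' where "(B, B') \<in> inv_pairs n" "col B k = v"
    "\<And>i. i < n \<Longrightarrow> i \<noteq> j \<Longrightarrow> i \<noteq> k \<Longrightarrow> col B i = unit_vec n i"
proof -
  define M where "M = mat n n (\<lambda>(i, l). if l = j then v $ i else if i = l then 1 else 0)"
  define M' where "M' = mat n n (\<lambda>(i, l). if l = j then (if i = j then 1 / v $ j else - (v $ i / v $ j))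
      else if i = l then 1 else 0)"
  define S where "S = (swaprows_mat n k j :: 'a mat)"
  have M: "M \<in> carrier_mat n n" "M' \<in> carrier_mat n n" by (auto simp: M_def M'_def)
  have "M * M' = 1\<^sub>m n"
  proof (rule eq_matI)
    fix i l assume il: "i < dim_row (1\<^sub>m n :: 'a mat)" "l < dim_col (1\<^sub>m n :: 'a mat)"
    have "(M * M') $$ (i, l) = (\<Sum>t<n. M $$ (i, t) * M' $$ (t, l))"
      using il M by (auto simp: scalar_prod_def atLeast0LessThan)
    also have "\<dots> = M $$ (i, j) * M' $$ (j, l) + (\<Sum>t\<in>{..<n} - {j}. M $$ (i, t) * M' $$ (t, l))"
      using j by (subst sum.remove[of _ j]) auto
    also have "(\<Sum>t\<in>{..<n} - {j}. M $$ (i, t) * M' $$ (t, l))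
        = (\<Sum>t\<in>{..<n} - {j}. if t = i then M' $$ (i, l) else 0)"
      using il by (intro sum.cong) (auto simp: M_def)
    also have "\<dots> = (if i = j then 0 else M' $$ (i, l))" using il by simp
    also have "M $$ (i, j) * M' $$ (j, l) + (if i = j then 0 else M' $$ (i, l)) = 1\<^sub>m n $$ (i, l)"
      using il j by (auto simp: M_def M'_def)
    finally show "(M * M') $$ (i, l) = 1\<^sub>m n $$ (i, l)" .
  qed (use M in auto)
  then have MM: "(M, M') \<in> inv_pairs n" using M by (intro inv_pairsI)
  have SS: "(S, S) \<in> inv_pairs n"
    unfolding S_def using k j by (intro inv_pairsI swaprows_mat_inv) auto
  have S: "S \<in> carrier_mat n n" using inv_pairsD[OF SS] by auto
  have "col (M * S) k = M *\<^sub>v col S k" by (rule col_mult2[OF M(1) S k])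
  also have "col S k = unit_vec n j" unfolding S_def using k j by (simp add: col_swaprows)
  also have "M *\<^sub>v unit_vec n j = v"
    using mult_unit_vec_col[OF M(1) j(1)] v j by (auto simp: M_def)
  finally have 1: "col (M * S) k = v" .
  have 2: "col (M * S) i = unit_vec n i" if "i < n" "i \<noteq> j" "i \<noteq> k" for i
  proof -
    have "col (M * S) i = M *\<^sub>v col S i" by (rule col_mult2[OF M(1) S that(1)])
    also have "col S i = unit_vec n i" unfolding S_def using that by (simp add: col_swaprows)
    also have "M *\<^sub>v unit_vec n i = unit_vec n i"
      using mult_unit_vec_col[OF M(1) that(1)] that by (auto simp: M_def unit_vec_def)
    finally show ?thesis .
  qed
  show thesis using that[OF inv_pairs_mult[OF MM SS] 1 2] .
qed

section \<open>Block triangular pairs\<close>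

text \<open>The lower left block is required to vanish for \<open>h\<close> only;
  \<open>block_pairs_swap\<close> transfers this to \<open>g\<close>. In the transvection argument
  it is the first two columns of \<open>h\<close> that are known directly.\<close>

definition block_pairs :: "nat \<Rightarrow> nat \<Rightarrow> ('a::field mat \<times> 'a mat) set" where
  "block_pairs k m = {(g, h) \<in> inv_pairs (k + m). \<forall>i j. i < m \<longrightarrow> j < k \<longrightarrow> h $$ (k + i, j) = 0}"

lemma four_block_mat_inject:
  assumes eq: "four_block_mat A B C D = four_block_mat A' B' C' D'"
    and 1: "A \<in> carrier_mat k l" "B \<in> carrier_mat k m" "C \<in> carrier_mat n l" "D \<in> carrier_mat n m"
    and 2: "A' \<in> carrier_mat k l" "B' \<in> carrier_mat k m" "C' \<in> carrier_mat n l" "D' \<in> carrier_mat n m"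
  shows "A = A'" "B = B'" "C = C'" "D = D'"
proof -
  have e: "four_block_mat A B C D $$ (i, j) = four_block_mat A' B' C' D' $$ (i, j)" for i j
    using eq by simp
  show "A = A'"
  proof (rule eq_matI)
    show "A $$ (i, j) = A' $$ (i, j)" if "i < dim_row A'" "j < dim_col A'" for i j
      using e[of i j] that 1 2 by simp
  qed (use 1 2 in auto)
  show "B = B'"
  proof (rule eq_matI)
    show "B $$ (i, j) = B' $$ (i, j)" if "i < dim_row B'" "j < dim_col B'" for i j
      using e[of i "l + j"] that 1 2 by simp
  qed (use 1 2 in auto)
  show "C = C'"
  proof (rule eq_matI)
    show "C $$ (i, j) = C' $$ (i, j)" if "i < dim_row C'" "j < dim_col C'" for i j
      using e[of "k + i" j] that 1 2 by simp
  qed (use 1 2 in auto)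
  show "D = D'"
  proof (rule eq_matI)
    show "D $$ (i, j) = D' $$ (i, j)" if "i < dim_row D'" "j < dim_col D'" for i j
      using e[of "k + i" "l + j"] that 1 2 by simp
  qed (use 1 2 in auto)
qed

text \<open>Multiplying out blocks when the lower left block of \<open>h\<close> is zero shows that
  the diagonal blocks are mutually inverse. Then \<open>D' * C = 0\<close> with \<open>D'\<close>
  invertible forces \<open>C = 0\<close>, and the upper right block of \<open>h\<close> is
  determined by that of \<open>g\<close>, which is arbitrary.\<close>

lemma bij_betw_block_pairs:
  "bij_betw (\<lambda>((A, A'), B, (D, D')).
      (four_block_mat A B (0\<^sub>m m k) D, four_block_mat A' (- (A' * B * D')) (0\<^sub>m m k) D'))
    (inv_pairs k \<times> carrier_mat k m \<times> inv_pairs m)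
    (block_pairs k m :: ('a::field mat \<times> 'a mat) set)"
  (is "bij_betw ?\<phi> ?S ?T")
proof (rule bij_betw_imageI)
  show "inj_on ?\<phi> ?S"
  proof (rule inj_onI)
    fix p p' :: "('a mat \<times> 'a mat) \<times> 'a mat \<times> 'a mat \<times> 'a mat"
    assume p: "p \<in> ?S" "p' \<in> ?S" and eq: "?\<phi> p = ?\<phi> p'"
    obtain A A' B D D' where P: "p = ((A, A'), B, (D, D'))" by (cases p) auto
    obtain a a' b d d' where P': "p' = ((a, a'), b, (d, d'))" by (cases p') auto
    have AD: "(A, A') \<in> inv_pairs k" "(a, a') \<in> inv_pairs k" "(D, D') \<in> inv_pairs m" "(d, d') \<in> inv_pairs m"
      and Bb: "B \<in> carrier_mat k m" "b \<in> carrier_mat k m"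
      using p P P' by auto
    have eq': "four_block_mat A B (0\<^sub>m m k) D = four_block_mat a b (0\<^sub>m m k) d"
      using eq unfolding P P' by simp
    have "A = a" "B = b" "D = d"
      using four_block_mat_inject[OF eq' inv_pairsD(1)[OF AD(1)] Bb(1) zero_carrier_mat
          inv_pairsD(1)[OF AD(3)] inv_pairsD(1)[OF AD(2)] Bb(2) zero_carrier_mat inv_pairsD(1)[OF AD(4)]]
      by auto
    then show "p = p'" unfolding P P' using AD inv_pairs_inverse_unique by blast
  qed
  show "?\<phi> ` ?S = ?T"
  proof (intro equalityI subsetI)
    fix p assume "p \<in> ?\<phi> ` ?S"
    then obtain A A' B D D' where A: "(A, A') \<in> inv_pairs k" and B: "B \<in> carrier_mat k m"
      and D: "(D, D') \<in> inv_pairs m"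
      and p: "p = (four_block_mat A B (0\<^sub>m m k) D, four_block_mat A' (- (A' * B * D')) (0\<^sub>m m k) D')"
      by auto
    note a = inv_pairsD[OF A] and d = inv_pairsD[OF D]
    have BD: "B * D' \<in> carrier_mat k m" using B d by auto
    have "A * (- (A' * B * D')) = - (A * (A' * (B * D')))"
      using a B d by (subst assoc_mult_mat[of A' k k B m D' m]) auto
    also have "A * (A' * (B * D')) = B * D'"
      using assoc_mult_mat[OF a(1,2) BD] a(3) left_mult_one_mat[OF BD] by simp
    finally have 1: "A * (- (A' * B * D')) + B * D' = 0\<^sub>m k m"
      using BD by (auto intro!: eq_matI)
    have uz: "- 0\<^sub>m m m = (0\<^sub>m m m :: 'a mat)" by (rule eq_matI) auto
    have "four_block_mat A B (0\<^sub>m m k) D * four_block_mat A' (- (A' * B * D')) (0\<^sub>m m k) D'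
        = 1\<^sub>m (k + m)"
      using a d B 1 by (subst mult_four_block_mat[of _ k k _ m _ m _ _ k _ m]) (auto simp: uz)
    then have "p \<in> inv_pairs (k + m)"
      unfolding p using a d B by (intro inv_pairsI) auto
    then show "p \<in> ?T" using a d B unfolding p block_pairs_def by auto
  next
    fix p :: "'a mat \<times> 'a mat" assume "p \<in> ?T"
    then obtain g h where p: "p = (g, h)" and gh: "(g, h) \<in> inv_pairs (k + m)"
      and z: "\<And>i j. i < m \<Longrightarrow> j < k \<Longrightarrow> h $$ (k + i, j) = 0"
      by (auto simp: block_pairs_def)
    note dgh = inv_pairsD[OF gh]
    obtain A B C D where sg: "split_block g k k = (A, B, C, D)" by (metis prod_cases4)
    obtain A' B' C' D' where sh: "split_block h k k = (A', B', C', D')" by (metis prod_cases4)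
    have g: "A \<in> carrier_mat k k" "B \<in> carrier_mat k m" "C \<in> carrier_mat m k" "D \<in> carrier_mat m m"
      "g = four_block_mat A B C D"
      using split_block[OF sg, of m m] dgh by auto
    have h: "A' \<in> carrier_mat k k" "B' \<in> carrier_mat k m" "C' \<in> carrier_mat m k" "D' \<in> carrier_mat m m"
      "h = four_block_mat A' B' C' D'"
      using split_block[OF sh, of m m] dgh by auto
    have C': "C' = 0\<^sub>m m k"
      using sh z dgh by (auto simp: split_block_def Let_def simp: add.commute)
    have mult1: "g * h = four_block_mat (A * A') (A * B' + B * D') (C * A') (C * B' + D * D')"
      unfolding g(5) h(5) C' using g h
      by (subst mult_four_block_mat[of _ k k _ m _ m _ _ k _ m]) (auto simp: right_add_zero_mat[of _ k k])
    have mult2: "h * g = four_block_mat (A' * A + B' * C) (A' * B + B' * D) (D' * C) (D' * D)"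
      unfolding g(5) h(5) C' using g h
      by (subst mult_four_block_mat[of _ k k _ m _ m _ _ k _ m]) auto
    have one: "1\<^sub>m (k + m) = four_block_mat (1\<^sub>m k) (0\<^sub>m k m) (0\<^sub>m m k) (1\<^sub>m m :: 'a mat)" by simp
    have "A * A' = 1\<^sub>m k" "A * B' + B * D' = 0\<^sub>m k m" "C * B' + D * D' = 1\<^sub>m m" "C * A' = 0\<^sub>m m k"
      using four_block_mat_inject[OF mult1[unfolded dgh(3) one, symmetric], of k k m m] g h by auto
    note m1 = this
    have "D' * D = 1\<^sub>m m" "D' * C = 0\<^sub>m m k"
      using four_block_mat_inject[OF mult2[unfolded dgh(4) one, symmetric], of k k m m] g h by auto
    note m2 = this
    have A: "(A, A') \<in> inv_pairs k" using m1(1) g h by (intro inv_pairsI)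
    have D: "(D, D') \<in> inv_pairs m" using m2(1) g h inv_pairsI inv_pairs_swap by blast
    note a = inv_pairsD[OF A] and d = inv_pairsD[OF D]
    have "C = D * (D' * C)"
      using assoc_mult_mat[OF d(1,2) g(3)] d(3) left_mult_one_mat[OF g(3)] by simp
    then have C: "C = 0\<^sub>m m k" using m2(2) right_mult_zero_mat[OF g(4)] by simp
    have "B' = A' * (A * B')"
      using assoc_mult_mat[OF a(2,1) h(2)] a(4) left_mult_one_mat[OF h(2)] by simp
    also have "A * B' = - (B * D')"
    proof (rule eq_matI)
      fix i j assume ij: "i < dim_row (- (B * D'))" "j < dim_col (- (B * D'))"
      have "(A * B' + B * D') $$ (i, j) = 0" unfolding m1(2) using ij g h by simp
      then show "(A * B') $$ (i, j) = (- (B * D')) $$ (i, j)"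
        using ij g h by (simp add: eq_neg_iff_add_eq_0 del: index_mult_mat(1))
    qed (use g h in auto)
    also have "A' * (- (B * D')) = - (A' * B * D')"
      using assoc_mult_mat[OF a(2) g(2) d(2)] a d g by simp
    finally have B': "B' = - (A' * B * D')" .
    have "p = ?\<phi> ((A, A'), B, (D, D'))"
      unfolding p g(5) h(5) C C' B' by simp
    then show "p \<in> ?\<phi> ` ?S" using A D g by blast
  qed
qed

text \<open>The parametrisation gives both components the same block triangular shape.\<close>

lemma block_pairs_swap:
  assumes "(g, h) \<in> block_pairs k m"
  shows "(h, g) \<in> block_pairs k m"
proof -
  have gh: "(g, h) \<in> inv_pairs (k + m)" using assms by (auto simp: block_pairs_def)
  have "(g, h) \<in> (\<lambda>((A, A'), B, (D, D')).
      (four_block_mat A B (0\<^sub>m m k) D, four_block_mat A' (- (A' * B * D')) (0\<^sub>m m k) D')) `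
    (inv_pairs k \<times> carrier_mat k m \<times> inv_pairs m)"
    using assms bij_betw_imp_surj_on[OF bij_betw_block_pairs] by blast
  then obtain A A' B D D' where "(A, A') \<in> inv_pairs k" "(D, D') \<in> inv_pairs m"
    and g: "g = four_block_mat A B (0\<^sub>m m k) D"
    by auto
  then have "A \<in> carrier_mat k k" "D \<in> carrier_mat m m" by (auto dest: inv_pairsD)
  then have "\<forall>i j. i < m \<longrightarrow> j < k \<longrightarrow> g $$ (k + i, j) = 0" unfolding g by auto
  then show ?thesis using gh by (auto simp: block_pairs_def inv_pairs_swap)
qed

lemma finite_block_pairs [simp]:
  "finite (block_pairs k m :: ('a::{finite,field} mat \<times> 'a mat) set)"
  by (rule finite_subset[OF _ finite_inv_pairs[of "k + m"]]) (auto simp: block_pairs_def)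

lemma sum_block_pairs:
  fixes T F E :: "'a::{finite,field} mat \<Rightarrow> 'a mat \<Rightarrow> complex"
  assumes T: "\<And>A A' B B' D D'. A \<in> carrier_mat k k \<Longrightarrow> A' \<in> carrier_mat k k \<Longrightarrow>
      D \<in> carrier_mat m m \<Longrightarrow> D' \<in> carrier_mat m m \<Longrightarrow>
      T (four_block_mat A B (0\<^sub>m m k) D) (four_block_mat A' B' (0\<^sub>m m k) D') = F A A' * E D D'"
  shows "(\<Sum>(g, h)\<in>block_pairs k m. T g h) =
    of_nat (card (UNIV :: 'a set)) ^ (k * m) * (\<Sum>(A, A')\<in>inv_pairs k. F A A') * (\<Sum>(D, D')\<in>inv_pairs m. E D D')"
proof -
  have "(\<Sum>(g, h)\<in>block_pairs k m. T g h) =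
      (\<Sum>p\<in>inv_pairs k \<times> (carrier_mat k m :: 'a mat set) \<times> inv_pairs m. case p of ((A, A'), B, (D, D')) \<Rightarrow> F A A' * E D D')"
    by (subst sum.reindex_bij_betw[OF bij_betw_block_pairs, symmetric])
       (rule sum.cong[OF refl], auto intro!: T dest: inv_pairsD)
  also have "\<dots> = (\<Sum>(A, A')\<in>inv_pairs k. \<Sum>B\<in>(carrier_mat k m :: 'a mat set). \<Sum>(D, D')\<in>inv_pairs m. F A A' * E D D')"
    by (simp only: sum.cartesian_product split_def fst_conv snd_conv)
  also have "\<dots> = (\<Sum>(A, A')\<in>inv_pairs k. of_nat (card (UNIV :: 'a set)) ^ (k * m) * F A A' * (\<Sum>(D, D')\<in>inv_pairs m. E D D'))"
    by (intro sum.cong) (auto simp: card_carrier_mat sum_distrib_left split_def mult.assoc)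
  also have "\<dots> = (\<Sum>p\<in>inv_pairs k. of_nat (card (UNIV :: 'a set)) ^ (k * m) * F (fst p) (snd p)) * (\<Sum>(D, D')\<in>inv_pairs m. E D D')"
    by (simp add: sum_distrib_right split_def)
  finally show ?thesis by (simp add: sum_distrib_left split_def)
qed

section \<open>Additive characters\<close>

lemma add_char_add: "add_char lam \<Longrightarrow> lam (a + b) = lam a * lam b"
  by (simp add: add_char_def)

lemma add_char_0: "add_char lam \<Longrightarrow> lam 0 = 1"
  using add_char_add[of lam 0 0] by (auto simp: add_char_def)

text \<open>For nonzero \<open>c\<close>, translating the summation variable by \<open>a / c\<close>
  with \<open>lam a \<noteq> 1\<close> multiplies the sum by \<open>lam a\<close>, so the sum
  vanishes.\<close>

lemma sum_nontrivial_char: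
  fixes lam :: "'a::{finite,field} \<Rightarrow> complex"
  assumes "add_char lam" and "nontrivial_char lam"
  shows "(\<Sum>t\<in>UNIV. lam (t * c)) = (if c = 0 then of_nat (card (UNIV :: 'a set)) else 0)"
proof (cases "c = 0")
  case True
  then show ?thesis using add_char_0[OF assms(1)] by simp
next
  case False
  obtain a where a: "lam a \<noteq> 1" using assms(2) by (auto simp: nontrivial_char_def)
  have "(\<Sum>t\<in>UNIV. lam (t * c)) = (\<Sum>t\<in>UNIV. lam ((a / c + t) * c))"
    by (rule sum.reindex_bij_betw[symmetric]) (auto intro: bij_betwI[of _ _ _ "\<lambda>t. t - a / c"])
  also have "\<dots> = lam a * (\<Sum>t\<in>UNIV. lam (t * c))"
    using False by (simp add: distrib_right add_char_add[OF assms(1)] sum_distrib_left)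
  finally show ?thesis using a False by simp
qed

text \<open>Averaging over \<open>t\<close> leaves the sum unchanged, since each
  \<open>\<tau> t\<close> only permutes \<open>X\<close>. It also replaces \<open>F p\<close> by
  \<open>F p\<close> times the mean of \<open>lam (t * c p)\<close>, which is 1 or 0 according to
  whether \<open>c p\<close> vanishes.\<close>

lemma sum_char_translates:
  fixes lam :: "'a::{finite,field} \<Rightarrow> complex"
  assumes lam: "add_char lam" "nontrivial_char lam" and X: "finite X"
    and bij: "\<And>t. bij_betw (\<tau> t) X X"
    and F: "\<And>t p. p \<in> X \<Longrightarrow> F (\<tau> t p) = F p * lam (t * c p)"
  shows "(\<Sum>p\<in>X. F p) = (\<Sum>p | p \<in> X \<and> c p = 0. F p)"
proof -
  let ?q = "of_nat (card (UNIV :: 'a set)) :: complex"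
  have "?q * (\<Sum>p\<in>X. F p) = (\<Sum>t\<in>(UNIV :: 'a set). \<Sum>p\<in>X. F p)" by simp
  also have "\<dots> = (\<Sum>t\<in>UNIV. \<Sum>p\<in>X. F (\<tau> t p))"
    by (intro sum.cong refl sum.reindex_bij_betw[OF bij, symmetric])
  also have "\<dots> = (\<Sum>t\<in>UNIV. \<Sum>p\<in>X. F p * lam (t * c p))" by (simp add: F)
  also have "\<dots> = (\<Sum>p\<in>X. F p * (\<Sum>t\<in>UNIV. lam (t * c p)))"
    by (subst sum.swap) (simp add: sum_distrib_left)
  also have "\<dots> = (\<Sum>p\<in>X. if c p = 0 then ?q * F p else 0)"
    by (intro sum.cong refl) (simp add: sum_nontrivial_char[OF lam])
  also have "\<dots> = ?q * (\<Sum>p | p \<in> X \<and> c p = 0. F p)"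
    using X by (auto simp: sum_distrib_left sum.inter_filter intro!: sum.cong)
  finally show ?thesis by simp
qed

section \<open>Pairs with a prescribed first column\<close>

definition col_pairs :: "nat \<Rightarrow> 'a::field vec \<Rightarrow> ('a mat \<times> 'a mat) set" where
  "col_pairs n w = {(g, h) \<in> inv_pairs n. col g 0 = w}"

lemma finite_col_pairs [simp]: "finite (col_pairs n w :: ('a::{finite,field} mat \<times> 'a mat) set)"
  by (rule finite_subset[OF _ finite_inv_pairs[of n]]) (auto simp: col_pairs_def)

lemma col_pairs_zero:
  assumes "0 < n"
  shows "col_pairs n (0\<^sub>v n) = {}"
proof -
  have False if gh: "(g, h) \<in> inv_pairs n" and c: "col g 0 = 0\<^sub>v n" for g h :: "'a mat"
  proof -
    note d = inv_pairsD[OF gh]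
    have "unit_vec n 0 = col (h * g) 0" using d assms by simp
    also have "\<dots> = h *\<^sub>v 0\<^sub>v n" using col_mult2[OF d(2,1) assms] c by simp
    also have "\<dots> = 0\<^sub>v n" using d by (intro eq_vecI) auto
    finally have "(unit_vec n 0 :: 'a vec) $ 0 = 0\<^sub>v n $ 0" by simp
    then show False using assms by simp
  qed
  then show ?thesis by (auto simp: col_pairs_def)
qed

text \<open>Left multiplication by \<open>B\<close> carries the first column e_0 to B e_0. It does
  not respect traces and serves for counting.\<close>

lemma bij_betw_col_pairs_mult:
  assumes B: "(B, B') \<in> inv_pairs n" and n: "0 < n"
  shows "bij_betw (\<lambda>(g, h). (B * g, h * B')) (col_pairs n (unit_vec n 0)) (col_pairs n (col B 0))"
proof (rule bij_betwI[where g = "\<lambda>(g, h). (B' * g, h * B)"])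
  note b = inv_pairsD[OF B]
  have B': "(B', B) \<in> inv_pairs n" using B inv_pairs_swap by blast
  show "(\<lambda>(g, h). (B * g, h * B')) \<in> col_pairs n (unit_vec n 0) \<rightarrow> col_pairs n (col B 0)"
  proof clarify
    fix g h assume "(g, h) \<in> col_pairs n (unit_vec n 0 :: 'a vec)"
    then have gh: "(g, h) \<in> inv_pairs n" and c: "col g 0 = unit_vec n 0" by (auto simp: col_pairs_def)
    have "col (B * g) 0 = col B 0"
      using col_mult2[OF b(1) inv_pairsD(1)[OF gh] n] c mult_unit_vec_col[OF b(1) n] by simp
    then show "(B * g, h * B') \<in> col_pairs n (col B 0)"
      using inv_pairs_mult[OF B gh] by (simp add: col_pairs_def)
  qed
  show "(\<lambda>(g, h). (B' * g, h * B)) \<in> col_pairs n (col B 0) \<rightarrow> col_pairs n (unit_vec n 0)"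
  proof clarify
    fix g h assume "(g, h) \<in> col_pairs n (col B 0)"
    then have gh: "(g, h) \<in> inv_pairs n" and c: "col g 0 = col B 0" by (auto simp: col_pairs_def)
    have "col (B' * g) 0 = col (B' * B) 0"
      using col_mult2[OF b(2) inv_pairsD(1)[OF gh] n] c col_mult2[OF b(2,1) n] by simp
    also have "\<dots> = unit_vec n 0" using b n by simp
    finally show "(B' * g, h * B) \<in> col_pairs n (unit_vec n 0)"
      using inv_pairs_mult[OF B' gh] by (simp add: col_pairs_def)
  qed
qed (auto simp: col_pairs_def inv_pairs_cancel[OF B] dest: inv_pairsD)

text \<open>As \<open>B\<close> fixes e_0, so does its inverse, and hence B g B' e_0 = B g e_0 = B
  e_k. Unlike left multiplication, conjugation preserves both traces, so it can be used inside the
  Kloosterman sum.\<close>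

lemma bij_betw_col_pairs_conj:
  fixes B B' :: "'a::field mat"
  assumes B: "(B, B') \<in> inv_pairs n" and B0: "col B 0 = unit_vec n 0" and n: "0 < n" and k: "k < n"
  shows "bij_betw (\<lambda>(g, h). (B * g * B', B * h * B')) (col_pairs n (unit_vec n k)) (col_pairs n (col B k))"
proof (rule bij_betwI[where g = "\<lambda>(g, h). (B' * g * B, B' * h * B)"])
  note b = inv_pairsD[OF B]
  have B': "(B', B) \<in> inv_pairs n" using B inv_pairs_swap by blast
  have B'0: "col B' 0 = unit_vec n 0"
    using col_mult2[OF b(2,1) n] b n mult_unit_vec_col[OF b(2) n] B0 by simp
  have conj: "(C * g * C', C * h * C') \<in> inv_pairs n" "col (C * g * C') 0 = C *\<^sub>v col g 0"
    if C: "(C, C') \<in> inv_pairs n" "col C' 0 = unit_vec n 0" and gh: "(g, h) \<in> inv_pairs n"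
    for C C' g h :: "'a mat"
  proof -
    note c = inv_pairsD[OF C(1)] and d = inv_pairsD[OF gh]
    have C': "(C', C) \<in> inv_pairs n" using C inv_pairs_swap by blast
    show "(C * g * C', C * h * C') \<in> inv_pairs n"
      using inv_pairs_mult[OF inv_pairs_mult[OF C(1) gh] C'] assoc_mult_mat[OF c(1) d(2) c(2)] by simp
    have cg: "C * g \<in> carrier_mat n n" using c d by simp
    have "col (C * g * C') 0 = col (C * g) 0"
      using col_mult2[OF cg c(2) n] C(2) mult_unit_vec_col[OF cg n] by simp
    then show "col (C * g * C') 0 = C *\<^sub>v col g 0" using col_mult2[OF c(1) d(1) n] by simp
  qed
  show "(\<lambda>(g, h). (B * g * B', B * h * B')) \<in> col_pairs n (unit_vec n k) \<rightarrow> col_pairs n (col B k)"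
    using conj[OF B B'0] mult_unit_vec_col[OF b(1) k] by (auto simp: col_pairs_def)
  have "B' *\<^sub>v col B k = unit_vec n k" using col_mult2[OF b(2,1) k] b k by simp
  then show "(\<lambda>(g, h). (B' * g * B, B' * h * B)) \<in> col_pairs n (col B k) \<rightarrow> col_pairs n (unit_vec n k)"
    using conj[OF B' B0] by (auto simp: col_pairs_def)
  show "(case case p of (g, h) \<Rightarrow> (B * g * B', B * h * B') of (g, h) \<Rightarrow> (B' * g * B, B' * h * B)) = p"
    if "p \<in> col_pairs n (unit_vec n k)" for p
  proof -
    have "B' * (B * g * B') * B = g" if "g \<in> carrier_mat n n" for g
    proof -
      have "B' * (B * g * B') = g * B'"
        using assoc_mult_mat[OF b(1) that b(2)] inv_pairs_cancel(2)[OF B, of "g * B'"] that b by simp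
      then show ?thesis using inv_pairs_cancel(4)[OF B that] by simp
    qed
    then show ?thesis using that by (auto simp: col_pairs_def dest: inv_pairsD)
  qed
  show "(case case p of (g, h) \<Rightarrow> (B' * g * B, B' * h * B) of (g, h) \<Rightarrow> (B * g * B', B * h * B')) = p"
    if "p \<in> col_pairs n (col B k)" for p
  proof -
    have "B * (B' * g * B) * B' = g" if "g \<in> carrier_mat n n" for g
    proof -
      have "B * (B' * g * B) = g * B"
        using assoc_mult_mat[OF b(2) that b(1)] inv_pairs_cancel(1)[OF B, of "g * B"] that b by simp
      then show ?thesis using inv_pairs_cancel(3)[OF B that] by simp
    qed
    then show ?thesis using that by (auto simp: col_pairs_def dest: inv_pairsD)
  qed
qed

lemma mat_trace_conj:
  assumes B: "(B, B') \<in> inv_pairs n" and g: "g \<in> carrier_mat n n"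
  shows "mat_trace (B * g * B') = mat_trace g"
proof -
  have "mat_trace (B * g * B') = mat_trace (B' * (B * g))"
    using inv_pairsD[OF B] g by (intro mat_trace_mult_commute[of _ n n]) auto
  then show ?thesis using inv_pairs_cancel[OF B g] by simp
qed

lemma sum_inv_pairs_by_col:
  fixes F :: "'a::{finite,field} mat \<times> 'a mat \<Rightarrow> 'b::comm_monoid_add"
  assumes "W \<subseteq> carrier_vec n"
  shows "(\<Sum>p | p \<in> inv_pairs n \<and> col (fst p) 0 \<in> W. F p) = (\<Sum>w\<in>W. \<Sum>p\<in>col_pairs n w. F p)"
proof -
  have "finite W" using assms by (rule finite_subset) simp
  then have "(\<Sum>w\<in>W. sum F {p \<in> {p \<in> inv_pairs n. col (fst p) 0 \<in> W}. col (fst p) 0 = w})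
      = sum F {p \<in> inv_pairs n. col (fst p) 0 \<in> W}"
    by (intro sum.group) auto
  moreover have "{p \<in> {p \<in> inv_pairs n. col (fst p) 0 \<in> W}. col (fst p) 0 = w} = col_pairs n w"
    if "w \<in> W" for w
    using that by (auto simp: col_pairs_def)
  ultimately show ?thesis by (simp cong: sum.cong)
qed

section \<open>Kloosterman sums over the general linear group\<close>

definition mat_kloosterman :: "('a::{finite,field} \<Rightarrow> complex) \<Rightarrow> 'a \<Rightarrow> 'a \<Rightarrow> nat \<Rightarrow> complex" where
  "mat_kloosterman lam x y n = (\<Sum>(g, h)\<in>inv_pairs n. lam (x * mat_trace g + y * mat_trace h))"

lemma inv_pairs_0: "inv_pairs 0 = {(1\<^sub>m 0, 1\<^sub>m 0)}"
  by (auto simp: inv_pairs_def)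

lemma mat_kloosterman_0: "add_char lam \<Longrightarrow> mat_kloosterman lam x y 0 = 1"
  by (simp add: mat_kloosterman_def inv_pairs_0 mat_trace_def add_char_0)

lemma bij_betw_inv_pairs_1:
  "bij_betw (\<lambda>a. (mat 1 1 (\<lambda>_. a), mat 1 1 (\<lambda>_. 1 / a))) (UNIV - {0 :: 'a::field}) (inv_pairs 1)"
proof (rule bij_betwI[where g = "\<lambda>(g, h). g $$ (0, 0)"])
  show "(\<lambda>a. (mat 1 1 (\<lambda>_. a), mat 1 1 (\<lambda>_. 1 / a))) \<in> UNIV - {0 :: 'a} \<rightarrow> inv_pairs 1"
    by (auto intro!: inv_pairsI simp: scalar_prod_def)
  have inv: "g $$ (0, 0) * h $$ (0, 0) = 1" if "(g, h) \<in> inv_pairs 1" for g h :: "'a mat"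
  proof -
    note d = inv_pairsD[OF that]
    have "(g * h) $$ (0, 0) = g $$ (0, 0) * h $$ (0, 0)" using d(1,2) by (simp add: scalar_prod_def)
    moreover have "(g * h) $$ (0, 0) = 1" unfolding d(3) by simp
    ultimately show ?thesis by simp
  qed
  then show "(\<lambda>(g, h). g $$ (0, 0)) \<in> inv_pairs 1 \<rightarrow> UNIV - {0 :: 'a}" by force
  show "(mat 1 1 (\<lambda>_. case p of (g, h) \<Rightarrow> g $$ (0, 0)), mat 1 1 (\<lambda>_. 1 / (case p of (g, h) \<Rightarrow> g $$ (0, 0)))) = p"
    if p: "p \<in> inv_pairs 1" for p :: "'a mat \<times> 'a mat"
  proof -
    obtain g h where gh: "p = (g, h)" by (cases p)
    have "g $$ (0, 0) * h $$ (0, 0) = 1" using inv p gh by simp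
    then have "h $$ (0, 0) = 1 / g $$ (0, 0)" by (metis eq_divide_eq mult.commute mult_zero_left zero_neq_one)
    moreover have "g \<in> carrier_mat 1 1" "h \<in> carrier_mat 1 1" using p gh by (auto dest: inv_pairsD)
    ultimately show ?thesis unfolding gh by auto
  qed
qed auto

lemma mat_kloosterman_1: "mat_kloosterman lam x y 1 = kloosterman lam x y"
  unfolding mat_kloosterman_def kloosterman_def
  by (subst sum.reindex_bij_betw[OF bij_betw_inv_pairs_1, symmetric]) (simp add: mat_trace_def)

text \<open>This is the factorisation over diagonal blocks that \<open>sum_block_pairs\<close> asks
  for.\<close>

lemma trace_char_four_block:
  assumes "add_char lam" and "A \<in> carrier_mat k k" "A' \<in> carrier_mat k k"
    and "D \<in> carrier_mat m m" "D' \<in> carrier_mat m m"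
  shows "lam (x * mat_trace (four_block_mat A B C D) + y * mat_trace (four_block_mat A' B' C' D'))
    = lam (x * mat_trace A + y * mat_trace A') * lam (x * mat_trace D + y * mat_trace D')"
  using assms by (simp add: mat_trace_four_block[of _ k _ m] add_char_add[symmetric] algebra_simps)

lemma sum_block_pairs_1:
  fixes lam :: "'a::{finite,field} \<Rightarrow> complex"
  assumes "add_char lam"
  shows "(\<Sum>(g, h)\<in>block_pairs 1 m. lam (x * mat_trace g + y * mat_trace h))
    = of_nat (card (UNIV :: 'a set)) ^ m * kloosterman lam x y * mat_kloosterman lam x y m"
proof -
  let ?f = "\<lambda>g h :: 'a mat. lam (x * mat_trace g + y * mat_trace h)"
  show ?thesis
    using sum_block_pairs[where T = ?f and F = ?f and E = ?f, OF trace_char_four_block[OF assms], of 1 m]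
    by (simp add: mat_kloosterman_1[symmetric] mat_kloosterman_def)
qed

text \<open>These are the pairs for which e_0 is an eigenvector of \<open>g\<close>. The swap is
  needed because \<open>block_pairs\<close> constrains the inverse while the first column constrains
  \<open>g\<close>.\<close>

lemma block_pairs_1_eq:
  "block_pairs 1 m = {p \<in> inv_pairs (Suc m). col (fst p) 0 \<in> {w \<in> carrier_vec (Suc m). \<forall>i<m. w $ Suc i = 0}}"
proof (intro equalityI subsetI)
  fix p :: "'a mat \<times> 'a mat" assume p: "p \<in> block_pairs 1 m"
  obtain g h where gh: "p = (g, h)" by (cases p)
  have hg: "(h, g) \<in> block_pairs 1 m" using block_pairs_swap p gh by blast
  then have "g \<in> carrier_mat (Suc m) (Suc m)" by (auto simp: block_pairs_def dest: inv_pairsD)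
  with hg show "p \<in> {p \<in> inv_pairs (Suc m). col (fst p) 0 \<in> {w \<in> carrier_vec (Suc m). \<forall>i<m. w $ Suc i = 0}}"
    using p unfolding gh by (auto simp: block_pairs_def intro!: carrier_vecI)
next
  fix p :: "'a mat \<times> 'a mat"
  assume p: "p \<in> {p \<in> inv_pairs (Suc m). col (fst p) 0 \<in> {w \<in> carrier_vec (Suc m). \<forall>i<m. w $ Suc i = 0}}"
  obtain g h where gh: "p = (g, h)" by (cases p)
  have "(h, g) \<in> block_pairs 1 m"
    using p inv_pairs_swap[of g h "Suc m"] unfolding gh by (auto simp: block_pairs_def dest: inv_pairsD)
  then show "p \<in> block_pairs 1 m" unfolding gh by (rule block_pairs_swap)
qed

section \<open>The order of the general linear group\<close>

text \<open>The count is a complex sum over block triangular pairs of the indicator that the corner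
  entry is 1; exactly one element of \<open>inv_pairs 1\<close> meets this condition.\<close>

lemma card_col_pairs_unit:
  "card (col_pairs (Suc m) (unit_vec (Suc m) 0 :: 'a::{finite,field} vec))
    = card (UNIV :: 'a set) ^ m * card (inv_pairs m :: ('a mat \<times> 'a mat) set)"
proof -
  have 1: "col_pairs (Suc m) (unit_vec (Suc m) 0) = {p \<in> block_pairs 1 m. fst p $$ (0, 0) = (1 :: 'a)}"
    unfolding block_pairs_1_eq
  proof (intro equalityI subsetI)
    fix p :: "'a mat \<times> 'a mat" assume p: "p \<in> col_pairs (Suc m) (unit_vec (Suc m) 0)"
    then have c: "col (fst p) 0 = unit_vec (Suc m) 0" and P: "p \<in> inv_pairs (Suc m)" by (auto simp: col_pairs_def)
    have "fst p \<in> carrier_mat (Suc m) (Suc m)" using P by (cases p) (auto dest: inv_pairsD)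
    then have "fst p $$ (0, 0) = 1" using arg_cong[OF c, of "\<lambda>v. v $ 0"] by auto
    then show "p \<in> {p \<in> {p \<in> inv_pairs (Suc m). col (fst p) 0 \<in> {w \<in> carrier_vec (Suc m). \<forall>i<m. w $ Suc i = 0}}.
        fst p $$ (0, 0) = 1}"
      using P c by auto
  next
    fix p :: "'a mat \<times> 'a mat"
    assume "p \<in> {p \<in> {p \<in> inv_pairs (Suc m). col (fst p) 0 \<in> {w \<in> carrier_vec (Suc m). \<forall>i<m. w $ Suc i = 0}}.
        fst p $$ (0, 0) = 1}"
    then have P: "p \<in> inv_pairs (Suc m)" and z: "\<And>i. i < m \<Longrightarrow> col (fst p) 0 $ Suc i = 0" and o: "fst p $$ (0, 0) = 1"
      by auto
    have car: "fst p \<in> carrier_mat (Suc m) (Suc m)" using P by (cases p) (auto dest: inv_pairsD)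
    have "col (fst p) 0 = unit_vec (Suc m) 0"
    proof (rule eq_vecI)
      show "col (fst p) 0 $ i = unit_vec (Suc m) 0 $ i" if "i < dim_vec (unit_vec (Suc m) 0 :: 'a vec)" for i
        using that z[of "i - 1"] o car by (cases i) auto
    qed (use car in auto)
    then show "p \<in> col_pairs (Suc m) (unit_vec (Suc m) 0)" using P by (auto simp: col_pairs_def)
  qed
  have "complex_of_nat (card (col_pairs (Suc m) (unit_vec (Suc m) 0 :: 'a vec)))
      = (\<Sum>(g, h)\<in>block_pairs 1 m. if g $$ (0, 0) = (1 :: 'a) then 1 else 0)"
    unfolding 1 by (simp add: split_def sum.If_cases Int_def conj_commute)
  also have "\<dots> = of_nat (card (UNIV :: 'a set)) ^ (1 * m)
      * (\<Sum>(A, A')\<in>inv_pairs 1. if A $$ (0, 0) = (1 :: 'a) then 1 else 0)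
      * (\<Sum>(D, D')\<in>(inv_pairs m :: ('a mat \<times> 'a mat) set). 1)"
    by (rule sum_block_pairs) auto
  also have "(\<Sum>(A, A')\<in>inv_pairs 1. if A $$ (0, 0) = (1 :: 'a) then 1 else (0 :: complex)) = 1"
    by (subst sum.reindex_bij_betw[OF bij_betw_inv_pairs_1, symmetric]) simp
  also have "(\<Sum>(D, D')\<in>(inv_pairs m :: ('a mat \<times> 'a mat) set). 1 :: complex) = of_nat (card (inv_pairs m :: ('a mat \<times> 'a mat) set))"
    by (simp add: split_def)
  finally have "complex_of_nat (card (col_pairs (Suc m) (unit_vec (Suc m) 0 :: 'a vec)))
    = complex_of_nat (card (UNIV :: 'a set) ^ m * card (inv_pairs m :: ('a mat \<times> 'a mat) set))" by simp
  then show ?thesis by (simp only: of_nat_eq_iff)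
qed

text \<open>Every nonzero vector is the first column of some invertible \<open>B\<close>, so all
  fibres over nonzero columns have the size of the fibre over e_0, while the fibre over zero is
  empty.\<close>

lemma card_inv_pairs_Suc:
  "card (inv_pairs (Suc m) :: ('a::{finite,field} mat \<times> 'a mat) set)
    = (card (UNIV :: 'a set) ^ Suc m - 1) * (card (UNIV :: 'a set) ^ m * card (inv_pairs m :: ('a mat \<times> 'a mat) set))"
proof -
  let ?n = "Suc m" and ?c = "card (UNIV :: 'a set) ^ m * card (inv_pairs m :: ('a mat \<times> 'a mat) set)"
  have "card (col_pairs ?n w) = ?c" if w: "w \<in> carrier_vec ?n - {0\<^sub>v ?n}" for w :: "'a vec"
  proof -
    obtain j where j: "j < ?n" "w $ j \<noteq> 0" using w by (metis Diff_iff carrier_vecD eq_vecI index_zero_vec singletonI)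
    obtain B B' where B: "(B, B') \<in> inv_pairs ?n" "col B 0 = w"
      by (rule obtain_inv_pair_col[of w ?n j 0]) (use w j in auto)
    show ?thesis
      using bij_betw_same_card[OF bij_betw_col_pairs_mult[OF B(1)]] B(2) card_col_pairs_unit[of m, where 'a = 'a]
      by simp
  qed
  note c = this
  have "card (inv_pairs ?n :: ('a mat \<times> 'a mat) set)
      = (\<Sum>p | p \<in> inv_pairs ?n \<and> col (fst p) 0 \<in> (carrier_vec ?n :: 'a vec set). 1)"
    by (subst card_eq_sum, rule sum.cong) (auto intro!: carrier_vecI dest: inv_pairsD(1))
  also have "\<dots> = (\<Sum>w\<in>(carrier_vec ?n :: 'a vec set). card (col_pairs ?n w))"
    by (subst sum_inv_pairs_by_col) auto
  also have "\<dots> = (\<Sum>w\<in>carrier_vec ?n - {0\<^sub>v ?n :: 'a vec}. card (col_pairs ?n w))"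
    by (subst sum.remove[of _ "0\<^sub>v ?n"]) (auto simp: col_pairs_zero)
  also have "\<dots> = (\<Sum>w\<in>carrier_vec ?n - {0\<^sub>v ?n :: 'a vec}. ?c)"
    by (rule sum.cong[OF refl c])
  finally show ?thesis by (simp add: card_Diff_subset card_carrier_vec)
qed

section \<open>Averaging over transvections\<close>

text \<open>On the right, the transvection \<open>addrow_mat n t 0 j\<close> adds \<open>t\<close>
  times column 0 to column \<open>j\<close>; on the left, it adds \<open>t\<close> times row
  \<open>j\<close> to row 0.\<close>

lemma mult_addrow_mat_index:
  assumes "(g :: 'a::field mat) \<in> carrier_mat n n" and "j < n" and "i < n" "l < n"
  shows "(g * addrow_mat n t 0 j) $$ (i, l) = (if l = j then t * g $$ (i, 0) + g $$ (i, l) else g $$ (i, l))"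
  using assms by (subst addcol_mat[OF assms(1), symmetric]) auto

lemma addrow_mat_mult_index:
  assumes "h \<in> carrier_mat n n" and "j < n" and "i < n" "l < n"
  shows "(addrow_mat n t 0 j * h) $$ (i, l) = (if i = 0 then t * h $$ (j, l) + h $$ (i, l) else h $$ (i, l))"
  using assms by (subst addrow_mat[OF assms(1), symmetric]) auto

lemma mat_trace_mult_addrow_mat:
  assumes "(g :: 'a::field mat) \<in> carrier_mat n n" and "j < n"
  shows "mat_trace (g * addrow_mat n t 0 j) = mat_trace g + t * g $$ (j, 0)"
proof -
  have "mat_trace (g * addrow_mat n t 0 j) = (\<Sum>i<n. g $$ (i, i) + (if i = j then t * g $$ (j, 0) else 0))"
    using assms unfolding mat_trace_def
    by (intro sum.cong) (auto simp: mult_addrow_mat_index simp del: index_mult_mat(1))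
  then show ?thesis using assms by (simp add: sum.distrib mat_trace_def)
qed

lemma mat_trace_addrow_mat_mult:
  assumes "(h :: 'a::field mat) \<in> carrier_mat n n" and "j < n"
  shows "mat_trace (addrow_mat n t 0 j * h) = mat_trace h + t * h $$ (j, 0)"
  using mat_trace_mult_commute[OF assms(1) addrow_mat_carrier, of t 0 j] mat_trace_mult_addrow_mat[OF assms, of t]
  by simp

text \<open>The pairs on which the transvections \<open>(g, h) \<mapsto> (g * U, inverse U * h)\<close> with
  \<open>U = 1 + t * E\<^sub>0\<^sub>j\<close> and \<open>0 < j < J\<close> leave the summand of the Kloosterman sum invariant.\<close>

definition stable_pairs :: "'a::field \<Rightarrow> 'a \<Rightarrow> nat \<Rightarrow> 'a vec \<Rightarrow> nat \<Rightarrow> ('a mat \<times> 'a mat) set" where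
  "stable_pairs x y n w J = {(g, h) \<in> col_pairs n w. \<forall>j. 0 < j \<longrightarrow> j < J \<longrightarrow> x * g $$ (j, 0) = y * h $$ (j, 0)}"

text \<open>Since \<open>0 < j\<close>, column 0 of \<open>g\<close> is untouched, and
  \<open>h\<close> changes in row 0 only, whereas the stability conditions concern rows of positive
  index.\<close>

lemma transvection_stable_pairs:
  assumes gh: "(g, h) \<in> stable_pairs x y n w J" and j: "0 < j" "j < n" and J: "J \<le> n"
  shows "(g * addrow_mat n t 0 j, addrow_mat n (- t) 0 j * h) \<in> stable_pairs x y n w J"
proof -
  have 1: "(g, h) \<in> inv_pairs n" "col g 0 = w" using gh by (auto simp: stable_pairs_def col_pairs_def)
  note d = inv_pairsD[OF 1(1)]
  have U: "(addrow_mat n t 0 j, addrow_mat n (- t) 0 j) \<in> inv_pairs n"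
    using j by (intro inv_pairsI addrow_mat_inv) auto
  have "col (g * addrow_mat n t 0 j) 0 = col g 0"
    by (rule eq_vecI) (use d j in \<open>auto simp: mult_addrow_mat_index simp del: index_mult_mat(1)\<close>)
  then show ?thesis
    using inv_pairs_mult[OF 1(1) U] 1(2) gh d j J
    by (auto simp: stable_pairs_def col_pairs_def mult_addrow_mat_index addrow_mat_mult_index
        simp del: index_mult_mat(1))
qed

text \<open>The transvection with parameter \<open>t\<close> changes the argument of
  \<open>lam\<close> by \<open>t\<close> times \<open>x * g $$ (j, 0) - y * h $$ (j, 0)\<close>.
  Averaging keeps the pairs where this coefficient is zero, which is the stability condition at
  index \<open>j\<close>.\<close>

lemma sum_stable_pairs_Suc:
  fixes lam :: "'a::{finite,field} \<Rightarrow> complex"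
  assumes lam: "add_char lam" "nontrivial_char lam" and j: "j < n"
  shows "(\<Sum>(g, h)\<in>stable_pairs x y n w j. lam (x * mat_trace g + y * mat_trace h))
    = (\<Sum>(g, h)\<in>stable_pairs x y n w (Suc j). lam (x * mat_trace g + y * mat_trace h))"
\<comment> \<open>Index 0 carries no condition, so the sets for bounds 0 and 1 coincide.\<close>
proof (cases "j = 0")
  case True
  then show ?thesis by (simp add: stable_pairs_def)
next
  case False
  define U :: "'a \<Rightarrow> 'a mat" where "U t = addrow_mat n t 0 j" for t
  define \<tau> where "\<tau> t = (\<lambda>(g, h). (g * U t, U (- t) * h))" for t
  let ?X = "stable_pairs x y n w j"
  let ?F = "\<lambda>(g, h). lam (x * mat_trace g + y * mat_trace h)"
  let ?c = "\<lambda>(g, h). x * g $$ (j, 0) - y * h $$ (j, 0)"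
  have U: "(U t, U (- t)) \<in> inv_pairs n" for t
    unfolding U_def using j False by (intro inv_pairsI addrow_mat_inv) auto
  have car: "g \<in> carrier_mat n n" "h \<in> carrier_mat n n" if "(g, h) \<in> ?X" for g h
    using that by (auto simp: stable_pairs_def col_pairs_def dest: inv_pairsD)
  have X: "\<tau> t p \<in> ?X" if "p \<in> ?X" for t p
  proof -
    obtain g h where gh: "p = (g, h)" by (cases p)
    show ?thesis
      using transvection_stable_pairs[of g h x y n w j j t] that j False
      unfolding gh by (simp add: \<tau>_def U_def)
  qed
  have inv: "\<tau> (- t) (\<tau> t p) = p" if "p \<in> ?X" for t p
  proof -
    obtain g h where gh: "p = (g, h)" by (cases p)
    note c = car[OF that[unfolded gh]]
    show ?thesis unfolding gh \<tau>_def using inv_pairs_cancel[OF U[of t] c(1)] inv_pairs_cancel[OF U[of t] c(2)] by simp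
  qed
  have "bij_betw (\<tau> t) ?X ?X" for t
    using X inv[of _ t] inv[of _ "- t"] by (intro bij_betwI[where g = "\<tau> (- t)"]) auto
  moreover have "?F (\<tau> t p) = ?F p * lam (t * ?c p)" if "p \<in> ?X" for t p
  proof -
    obtain g h where gh: "p = (g, h)" by (cases p)
    note c = car[OF that[unfolded gh]]
    have "x * mat_trace (g * U t) + y * mat_trace (U (- t) * h)
        = (x * mat_trace g + y * mat_trace h) + t * ?c p"
      unfolding U_def gh using c j
      by (simp add: mat_trace_mult_addrow_mat mat_trace_addrow_mat_mult algebra_simps)
    then have "lam (x * mat_trace (g * U t) + y * mat_trace (U (- t) * h))
        = lam (x * mat_trace g + y * mat_trace h) * lam (t * ?c p)"
      by (simp only: add_char_add[OF lam(1), symmetric])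
    then show ?thesis unfolding gh by (simp add: \<tau>_def)
  qed
  moreover have "finite ?X"
    by (rule finite_subset[OF _ finite_col_pairs[of n w]]) (auto simp: stable_pairs_def)
  ultimately have "(\<Sum>p\<in>?X. ?F p) = (\<Sum>p | p \<in> ?X \<and> ?c p = 0. ?F p)"
    by (intro sum_char_translates[OF lam, where \<tau> = \<tau>]) auto
  also have "{p. p \<in> ?X \<and> ?c p = 0} = stable_pairs x y n w (Suc j)"
    using False by (auto simp: stable_pairs_def less_Suc_eq)
  finally show ?thesis .
qed

lemma sum_col_pairs_eq_sum_stable_pairs:
  fixes lam :: "'a::{finite,field} \<Rightarrow> complex"
  assumes lam: "add_char lam" "nontrivial_char lam"
  shows "(\<Sum>(g, h)\<in>col_pairs n w. lam (x * mat_trace g + y * mat_trace h))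
    = (\<Sum>(g, h)\<in>stable_pairs x y n w n. lam (x * mat_trace g + y * mat_trace h))"
proof -
  have "(\<Sum>(g, h)\<in>col_pairs n w. lam (x * mat_trace g + y * mat_trace h))
    = (\<Sum>(g, h)\<in>stable_pairs x y n w J. lam (x * mat_trace g + y * mat_trace h))" if "J \<le> n" for J
    using that
  proof (induction J)
    case 0
    then show ?case by (simp add: stable_pairs_def)
  next
    case (Suc J)
    then show ?case using sum_stable_pairs_Suc[OF lam, of J n x y w] by simp
  qed
  then show ?thesis by simp
qed

text \<open>From g e_0 = e_1 one gets h e_1 = e_0, and stability makes h e_0 proportional to g e_0
  in all entries but the first. So \<open>h\<close> preserves the span of e_0 and e_1; the condition
  at index 1 survives as \<open>x = y * h $$ (1, 0)\<close>.\<close>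

lemma stable_pairs_eq_block_pairs:
  assumes xy: "x \<noteq> 0" "y \<noteq> 0"
  shows "stable_pairs x y (Suc (Suc m)) (unit_vec (Suc (Suc m)) 1) (Suc (Suc m))
    = {(g, h) \<in> block_pairs 2 m. g $$ (0, 0) = 0 \<and> g $$ (1, 0) = 1 \<and> x = y * h $$ (1, 0)}"
    (is "?S = ?T")
proof (intro equalityI subsetI)
  let ?n = "Suc (Suc m)"
  fix p assume p: "p \<in> ?S"
  obtain g h where gh: "p = (g, h)" by (cases p)
  have 1: "(g, h) \<in> inv_pairs ?n" and c: "col g 0 = unit_vec ?n 1"
    and z: "\<And>j. 0 < j \<Longrightarrow> j < ?n \<Longrightarrow> x * g $$ (j, 0) = y * h $$ (j, 0)"
    using p unfolding gh by (auto simp: stable_pairs_def col_pairs_def)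
  note d = inv_pairsD[OF 1]
  have g0: "g $$ (j, 0) = (if j = 1 then 1 else 0)" if "j < ?n" for j
    using arg_cong[OF c, of "\<lambda>v. v $ j"] that d(1,2) by auto
  have "col h 1 = col (h * g) 0"
    using col_mult2[OF d(2,1), of 0] c mult_unit_vec_col[OF d(2), of 1] by simp
  then have ch: "col h 1 = unit_vec ?n 0" using d by simp
  have h1: "h $$ (j, 1) = (if j = 0 then 1 else 0)" if "j < ?n" for j
    using arg_cong[OF ch, of "\<lambda>v. v $ j"] that d(1,2) by simp
  have h0: "h $$ (j, 0) = 0" if "1 < j" "j < ?n" for j
    using z[of j] g0[of j] that xy by auto
  have "h $$ (2 + i, j) = 0" if "i < m" "j < 2" for i j
    using h0[of "2 + i"] h1[of "2 + i"] that by (auto simp: less_2_cases_iff)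
  then have "(g, h) \<in> block_pairs 2 m" using 1 by (auto simp: block_pairs_def)
  then show "p \<in> ?T" using z[of 1] g0[of 0] g0[of 1] unfolding gh by auto
next
  let ?n = "Suc (Suc m)"
  fix p assume p: "p \<in> ?T"
  obtain g h where gh: "p = (g, h)" by (cases p)
  have b: "(g, h) \<in> block_pairs 2 m" and g: "g $$ (0, 0) = 0" "g $$ (1, 0) = 1" and h: "x = y * h $$ (1, 0)"
    using p unfolding gh by auto
  have 1: "(g, h) \<in> inv_pairs ?n" using b by (auto simp: block_pairs_def)
  note d = inv_pairsD[OF 1]
  have z: "g $$ (Suc (Suc i), 0) = 0" "h $$ (Suc (Suc i), 0) = 0" if "i < m" for i
    using b block_pairs_swap[OF b] that by (auto simp: block_pairs_def)
  have "col g 0 = unit_vec ?n 1"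
  proof (rule eq_vecI)
    fix i assume "i < dim_vec (unit_vec ?n 1 :: 'a vec)"
    then consider "i = 0" | "i = 1" | i' where "i = Suc (Suc i')" "i' < m"
      by (cases i; cases "i - 1") auto
    then show "col g 0 $ i = unit_vec ?n 1 $ i" using z g d(1) by cases auto
  qed (use d in auto)
  moreover have "x * g $$ (j, 0) = y * h $$ (j, 0)" if "0 < j" "j < ?n" for j
  proof -
    from that consider "j = 1" | i' where "j = Suc (Suc i')" "i' < m" by (cases "j - 1") (auto, metis Suc_pred)
    then show ?thesis using z g h by cases auto
  qed
  ultimately show "p \<in> ?S" using 1 unfolding gh by (auto simp: stable_pairs_def col_pairs_def)
qed

text \<open>The parameter \<open>c\<close> is the entry of \<open>A'\<close> at (0, 0), the only one
  left free: (1, 0) is prescribed, and the second column of \<open>A'\<close> is e_0 because A e_0 =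
  e_1. The matrix \<open>A\<close> is then the inverse of \<open>A'\<close>.\<close>

lemma corner_pairs_2:
  assumes "x \<noteq> 0" "y \<noteq> (0 :: 'a::field)"
  shows "{(A, A') \<in> inv_pairs 2. A $$ (0, 0) = 0 \<and> A $$ (1, 0) = 1 \<and> x = y * A' $$ (1, 0)}
    = range (\<lambda>c. (mat 2 2 (\<lambda>(i, j). if i = 0 then if j = 0 then 0 else y / x else if j = 0 then 1 else - (c * y / x)),
        mat 2 2 (\<lambda>(i, j). if i = 0 then if j = 0 then c else 1 else if j = 0 then x / y else 0)))"
    (is "?Z = range ?\<psi>")
proof (intro equalityI subsetI)
  have mem: "?\<psi> c \<in> inv_pairs 2" for c
    using assms by (intro inv_pairsI eq_matI) (auto simp: scalar_prod_def numeral_2_eq_2 less_Suc_eq)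
  show "p \<in> ?Z" if "p \<in> range ?\<psi>" for p
    using that mem assms by auto
  fix p assume p: "p \<in> ?Z"
  obtain A A' where A: "p = (A, A')" by (cases p)
  have AA: "(A, A') \<in> inv_pairs 2" and z: "A $$ (0, 0) = 0" "A $$ (1, 0) = 1" "x = y * A' $$ (1, 0)"
    using p A by auto
  note d = inv_pairsD[OF AA]
  have "(A' * A) $$ (i, 0) = A' $$ (i, 0) * A $$ (0, 0) + A' $$ (i, 1) * A $$ (1, 0)" if "i < 2" for i
    using d(1,2) that by (simp add: scalar_prod_def numeral_2_eq_2)
  then have "A' $$ (i, 1) = (if i = 0 then 1 else 0)" if "i < 2" for i
    using that z unfolding d(4) by (simp split: if_splits)
  then have "A' = snd (?\<psi> (A' $$ (0, 0)))"
    using d(2) z assms by (intro eq_matI) (auto simp: less_2_cases_iff)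
  then obtain c where A': "A' = snd (?\<psi> c)" by (rule that)
  have "(A', A) \<in> inv_pairs 2" using AA inv_pairs_swap by blast
  moreover have "(A', fst (?\<psi> c)) \<in> inv_pairs 2"
    using mem[of c] unfolding A' fst_conv snd_conv by (rule inv_pairs_swap[THEN iffD1])
  ultimately have "A = fst (?\<psi> c)" by (rule inv_pairs_inverse_unique)
  then have "p = ?\<psi> c" unfolding A A' by (simp only: fst_conv snd_conv)
  then show "p \<in> range ?\<psi>" by (rule range_eqI)
qed

text \<open>On the corner block \<open>x\<close> times the trace is \<open>- (c * y)\<close> and
  \<open>y\<close> times the trace of the inverse is \<open>c * y\<close>. Hence each value of
  \<open>c\<close> contributes 1, giving one more power of q beyond the q^(2m) upper right
  blocks.\<close>

lemma sum_col_pairs_unit_1: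
  fixes lam :: "'a::{finite,field} \<Rightarrow> complex"
  assumes lam: "add_char lam" "nontrivial_char lam" and xy: "x \<noteq> 0" "y \<noteq> 0"
  shows "(\<Sum>(g, h)\<in>col_pairs (Suc (Suc m)) (unit_vec (Suc (Suc m)) 1). lam (x * mat_trace g + y * mat_trace h))
    = of_nat (card (UNIV :: 'a set)) ^ Suc (2 * m) * mat_kloosterman lam x y m"
proof -
  let ?f = "\<lambda>g h. lam (x * mat_trace g + y * mat_trace h)"
  let ?P = "\<lambda>g h :: 'a mat. g $$ (0, 0) = 0 \<and> g $$ (1, 0) = 1 \<and> x = y * h $$ (1, 0)"
  \<comment> \<open>The constraints involve only the corner block, so they are absorbed into its
    factor as an indicator before \<open>sum_block_pairs\<close> is applied.\<close>
  let ?F = "\<lambda>g h. if ?P g h then ?f g h else 0"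
  let ?Z = "{(A, A') \<in> inv_pairs 2. ?P A A'}"
  let ?\<psi> = "\<lambda>c. (mat 2 2 (\<lambda>(i, j). if i = 0 then if j = 0 then 0 else y / x else if j = 0 then 1 else - (c * y / x)),
        mat 2 2 (\<lambda>(i, j). if i = 0 then if j = 0 then c else 1 else if j = 0 then x / y else 0))"
  have "(\<Sum>(g, h)\<in>col_pairs (Suc (Suc m)) (unit_vec (Suc (Suc m)) 1). ?f g h) =
      (\<Sum>(g, h)\<in>{(g, h) \<in> block_pairs 2 m. ?P g h}. ?f g h)"
    unfolding sum_col_pairs_eq_sum_stable_pairs[OF lam] stable_pairs_eq_block_pairs[OF xy] ..
  also have "\<dots> = (\<Sum>(g, h)\<in>block_pairs 2 m. ?F g h)"
    by (rule sum.mono_neutral_cong_left) (auto split: if_splits)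
  also have "\<dots> = of_nat (card (UNIV :: 'a set)) ^ (2 * m) * (\<Sum>(A, A')\<in>inv_pairs 2. ?F A A')
      * (\<Sum>(D, D')\<in>inv_pairs m. ?f D D')"
    by (rule sum_block_pairs) (auto simp: trace_char_four_block[OF lam(1)])
  also have "(\<Sum>(A, A')\<in>inv_pairs 2. ?F A A') = (\<Sum>(A, A')\<in>?Z. ?f A A')"
    by (rule sum.mono_neutral_cong_right) (auto split: if_splits)
  also have "\<dots> = (\<Sum>p\<in>range ?\<psi>. ?f (fst p) (snd p))"
    unfolding corner_pairs_2[OF xy] by (simp add: split_def)
  also have "\<dots> = (\<Sum>c\<in>(UNIV :: 'a set). ?f (fst (?\<psi> c)) (snd (?\<psi> c)))"
  proof (subst sum.reindex)
    have "c = c'" if "?\<psi> c = ?\<psi> c'" for c c'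
      using arg_cong[OF that, of "\<lambda>p. snd p $$ (0, 0)"] by simp
    then show "inj ?\<psi>" by (rule injI)
  qed (simp add: o_def)
  also have "\<dots> = (\<Sum>c\<in>(UNIV :: 'a set). 1)"
    using xy by (intro sum.cong refl) (simp add: mat_trace_def numeral_2_eq_2 add_char_0[OF lam(1)] field_simps)
  finally show ?thesis by (simp add: mat_kloosterman_def)
qed

section \<open>The recurrence for the matrix Kloosterman sums\<close>

text \<open>A nonzero entry of \<open>w\<close> at positive index allows an invertible
  \<open>B\<close> with B e_0 = e_0 and B e_1 = w; conjugation by it preserves traces.\<close>

lemma sum_col_pairs_off_axis:
  fixes lam :: "'a::{finite,field} \<Rightarrow> complex"
  assumes w: "w \<in> carrier_vec (Suc (Suc m))" and j: "j < Suc m" "w $ Suc j \<noteq> 0"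
  shows "(\<Sum>(g, h)\<in>col_pairs (Suc (Suc m)) w. lam (x * mat_trace g + y * mat_trace h))
    = (\<Sum>(g, h)\<in>col_pairs (Suc (Suc m)) (unit_vec (Suc (Suc m)) 1). lam (x * mat_trace g + y * mat_trace h))"
proof -
  let ?n = "Suc (Suc m)"
  obtain B B' where B: "(B, B') \<in> inv_pairs ?n" "col B 1 = w" "col B 0 = unit_vec ?n 0"
  proof (rule obtain_inv_pair_col[of w ?n "Suc j" 1])
    fix B B' assume "(B, B') \<in> inv_pairs ?n" "col B 1 = w"
      "\<And>i. i < ?n \<Longrightarrow> i \<noteq> Suc j \<Longrightarrow> i \<noteq> 1 \<Longrightarrow> col B i = unit_vec ?n i"
    then show thesis by (intro that) auto
  qed (use w j in auto)
  have "mat_trace (B * g * B') = mat_trace g" "mat_trace (B * h * B') = mat_trace h"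
    if "(g, h) \<in> inv_pairs ?n" for g h
    using mat_trace_conj[OF B(1)] inv_pairsD[OF that] by auto
  then show ?thesis
    unfolding B(2)[symmetric]
    by (subst sum.reindex_bij_betw[OF bij_betw_col_pairs_conj[OF B(1,3), of 1], symmetric])
       (auto intro!: sum.cong simp: col_pairs_def)
qed

text \<open>The complement is the line through e_0, zero vector included, which has as many points
  as the field.\<close>

lemma card_off_axis:
  "card {w \<in> carrier_vec (Suc m) :: 'a::{finite,field} vec set. \<not> (\<forall>i<m. w $ Suc i = 0)}
    = card (UNIV :: 'a set) ^ Suc m - card (UNIV :: 'a set)"
proof -
  let ?n = "Suc m"
  let ?e = "\<lambda>a :: 'a. vec ?n (\<lambda>i. if i = 0 then a else 0)"
  have "{w \<in> carrier_vec ?n :: 'a vec set. \<forall>i<m. w $ Suc i = 0} = range ?e"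
  proof (intro equalityI subsetI)
    fix w :: "'a vec" assume w: "w \<in> {w \<in> carrier_vec ?n. \<forall>i<m. w $ Suc i = 0}"
    have "w = ?e (w $ 0)"
    proof (rule eq_vecI)
      show "w $ i = ?e (w $ 0) $ i" if "i < dim_vec (?e (w $ 0))" for i
        using that w by (cases i) auto
    qed (use w in auto)
    then show "w \<in> range ?e" by blast
  qed auto
  moreover have "inj ?e"
  proof (rule injI)
    show "a = b" if "?e a = ?e b" for a b using arg_cong[OF that, of "\<lambda>v. v $ 0"] by simp
  qed
  ultimately have "card {w \<in> carrier_vec ?n :: 'a vec set. \<forall>i<m. w $ Suc i = 0} = card (UNIV :: 'a set)"
    by (simp add: card_image)
  moreover have "{w \<in> carrier_vec ?n :: 'a vec set. \<not> (\<forall>i<m. w $ Suc i = 0)}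
      = carrier_vec ?n - {w \<in> carrier_vec ?n. \<forall>i<m. w $ Suc i = 0}" by auto
  ultimately show ?thesis by (simp add: card_Diff_subset card_carrier_vec)
qed

lemma mat_kloosterman_split:
  fixes lam :: "'a::{finite,field} \<Rightarrow> complex"
  assumes lam: "add_char lam"
  shows "mat_kloosterman lam x y (Suc m) =
    of_nat (card (UNIV :: 'a set)) ^ m * kloosterman lam x y * mat_kloosterman lam x y m
    + (\<Sum>w | w \<in> carrier_vec (Suc m) \<and> \<not> (\<forall>i<m. w $ Suc i = 0).
        \<Sum>(g, h)\<in>col_pairs (Suc m) w. lam (x * mat_trace g + y * mat_trace h))"
proof -
  let ?W = "{w :: 'a vec. w \<in> carrier_vec (Suc m) \<and> \<not> (\<forall>i<m. w $ Suc i = 0)}"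
  let ?f = "\<lambda>(g, h). lam (x * mat_trace g + y * mat_trace h)"
  let ?Y = "{p \<in> inv_pairs (Suc m). col (fst p) 0 \<in> ?W}"
  have un: "inv_pairs (Suc m) = block_pairs 1 m \<union> ?Y"
    unfolding block_pairs_1_eq by (auto intro!: carrier_vecI dest: inv_pairsD(1))
  have dis: "block_pairs 1 m \<inter> ?Y = {}" unfolding block_pairs_1_eq by auto
  have fin: "finite ?Y" by simp
  have "sum ?f (inv_pairs (Suc m)) = sum ?f (block_pairs 1 m \<union> ?Y)"
    by (rule arg_cong[OF un])
  also have "\<dots> = sum ?f (block_pairs 1 m) + sum ?f ?Y"
    by (rule sum.union_disjoint[OF finite_block_pairs fin dis])
  finally have "sum ?f (inv_pairs (Suc m)) = sum ?f (block_pairs 1 m) + sum ?f ?Y" .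
  moreover have "sum ?f ?Y = (\<Sum>w\<in>?W. sum ?f (col_pairs (Suc m) w))"
    by (rule sum_inv_pairs_by_col) auto
  ultimately show ?thesis
    unfolding mat_kloosterman_def[of _ _ _ "Suc m"] sum_block_pairs_1[OF lam] by simp
qed

text \<open>All first columns off the line of e_0 contribute the same amount as e_1, so the second
  sum in \<open>mat_kloosterman_split\<close> is the number of such columns times
  \<open>sum_col_pairs_unit_1\<close>.\<close>

lemma mat_kloosterman_Suc_Suc:
  fixes lam :: "'a::{finite,field} \<Rightarrow> complex"
  assumes lam: "add_char lam" "nontrivial_char lam" and xy: "x \<noteq> 0" "y \<noteq> 0"
  shows "mat_kloosterman lam x y (Suc (Suc m)) =
    of_nat (card (UNIV :: 'a set)) ^ Suc m * kloosterman lam x y * mat_kloosterman lam x y (Suc m)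
    + of_nat (card (UNIV :: 'a set) ^ Suc (Suc m) - card (UNIV :: 'a set))
      * of_nat (card (UNIV :: 'a set)) ^ Suc (2 * m) * mat_kloosterman lam x y m"
proof -
  let ?n = "Suc (Suc m)"
  let ?W = "{w :: 'a vec. w \<in> carrier_vec ?n \<and> \<not> (\<forall>i<Suc m. w $ Suc i = 0)}"
  have "(\<Sum>w\<in>?W. \<Sum>(g, h)\<in>col_pairs ?n w. lam (x * mat_trace g + y * mat_trace h))
    = (\<Sum>w\<in>?W. of_nat (card (UNIV :: 'a set)) ^ Suc (2 * m) * mat_kloosterman lam x y m)"
  proof (rule sum.cong[OF refl])
    fix w assume "w \<in> ?W"
    then obtain j where "w \<in> carrier_vec ?n" "j < Suc m" "w $ Suc j \<noteq> 0" by blast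
    then show "(\<Sum>(g, h)\<in>col_pairs ?n w. lam (x * mat_trace g + y * mat_trace h))
      = of_nat (card (UNIV :: 'a set)) ^ Suc (2 * m) * mat_kloosterman lam x y m"
      using sum_col_pairs_off_axis[of w m j lam x y] sum_col_pairs_unit_1[OF lam xy, of m] by simp
  qed
  also have "\<dots> = of_nat (card (UNIV :: 'a set) ^ ?n - card (UNIV :: 'a set))
      * of_nat (card (UNIV :: 'a set)) ^ Suc (2 * m) * mat_kloosterman lam x y m"
    using card_off_axis[of "Suc m", where 'a = 'a] by (simp add: mult.assoc)
  finally show ?thesis unfolding mat_kloosterman_split[OF lam(1), of x y "Suc m"] by simp
qed

section \<open>The infinite product\<close>

text \<open>\<open>GL_factor\<close> is the case where \<open>q\<close> and \<open>d\<close> are the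
  field size and \<open>b\<close> is the Kloosterman sum; the analytic part needs no finite
  field.\<close>

definition quad_factor :: "complex \<Rightarrow> complex \<Rightarrow> complex \<Rightarrow> nat \<Rightarrow> complex fps" where
  "quad_factor q b d i = 1 + fps_const (b / q ^ i) * fps_X + fps_const (d / q ^ (2 * i)) * fps_X ^ 2"

lemma fps_nth_mult_quad_factor:
  "fps_nth (P * quad_factor q b d i) n = fps_nth P n
    + (if n < 1 then 0 else b / q ^ i * fps_nth P (n - 1))
    + (if n < 2 then 0 else d / q ^ (2 * i) * fps_nth P (n - 2))"
proof -
  have "P * quad_factor q b d i = P + fps_const (b / q ^ i) * (P * fps_X) + fps_const (d / q ^ (2 * i)) * (P * fps_X ^ 2)"
    by (simp add: quad_factor_def algebra_simps)
  then show ?thesis by (simp add: fps_X_power_mult_right_nth)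
qed

text \<open>The factor with index i is a fixed polynomial in u / q^i, so replacing u by q u lowers
  the index by one.\<close>

lemma quad_factor_scale:
  assumes "q \<noteq> 0"
  shows "fps_compose (quad_factor q b d (Suc i)) (fps_const q * fps_X) = quad_factor q b d i"
  using assms
  by (simp add: quad_factor_def fps_compose_add_distrib fps_compose_mult_distrib power_mult_distrib
      power2_eq_square flip: fps_compose_power mult.assoc)

text \<open>The finite form of the functional equation: every index drops by one, so the factor with
  index 0 enters and the last one leaves.\<close>

lemma prod_quad_factor_scale:
  assumes "q \<noteq> 0"
  shows "fps_compose (\<Prod>i\<in>{1..Suc N}. quad_factor q b d i) (fps_const q * fps_X)
    = quad_factor q b d 0 * (\<Prod>i\<in>{1..N}. quad_factor q b d i)"
proof (induction N)
  case 0
  show ?case using quad_factor_scale[OF assms, of b d 0] by simp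
next
  case (Suc N)
  have "fps_compose (\<Prod>i\<in>{1..Suc (Suc N)}. quad_factor q b d i) (fps_const q * fps_X)
    = fps_compose (\<Prod>i\<in>{1..Suc N}. quad_factor q b d i) (fps_const q * fps_X) * quad_factor q b d (Suc N)"
    by (simp add: fps_compose_mult_distrib quad_factor_scale[OF assms])
  then show ?case unfolding Suc.IH by (simp add: mult.assoc)
qed

text \<open>Comparing the partial product \<open>P\<^sub>N\<^sub>+\<^sub>1 = P\<^sub>N * F\<^sub>N\<^sub>+\<^sub>1\<close> at \<open>u\<close> and at \<open>q * u\<close> eliminates
  \<open>P\<^sub>N\<^sub>+\<^sub>1\<close> and leaves a recurrence in the coefficient index alone.\<close>

lemma fps_nth_prod_quad_factor:
  fixes q b d :: complex
  assumes q: "q \<noteq> 0"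
  defines "p \<equiv> \<lambda>N. fps_nth (\<Prod>i\<in>{1..N::nat}. quad_factor q b d i)"
  shows "(q ^ n - 1) * p N n = (if n < 1 then 0 else b * (1 - q ^ n / q ^ Suc N) * p N (n - 1))
    + (if n < 2 then 0 else d * (1 - q ^ n / q ^ (2 * Suc N)) * p N (n - 2))"
proof -
  let ?P = "\<lambda>N::nat. \<Prod>i\<in>{1..N}. quad_factor q b d i"
  have 1: "p (Suc N) n = p N n + (if n < 1 then 0 else b / q ^ Suc N * p N (n - 1))
      + (if n < 2 then 0 else d / q ^ (2 * Suc N) * p N (n - 2))"
    using fps_nth_mult_quad_factor[of "?P N" q b d "Suc N" n] by (simp add: p_def)
  \<comment> \<open>Substituting q u for u multiplies the coefficient of u^n by q^n.\<close>
  have "q ^ n * p (Suc N) n = fps_nth (?P N * quad_factor q b d 0) n"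
    using arg_cong[OF prod_quad_factor_scale[OF q, of b d N], of "\<lambda>f. fps_nth f n"]
    by (simp add: p_def fps_compose_linear mult.commute[of "quad_factor q b d 0"]
        del: prod.cl_ivl_Suc)
  also have "\<dots> = p N n + (if n < 1 then 0 else b * p N (n - 1)) + (if n < 2 then 0 else d * p N (n - 2))"
    unfolding fps_nth_mult_quad_factor by (simp add: p_def)
  finally show ?thesis
    unfolding 1 by (cases "n < 1"; cases "n < 2") (simp_all add: algebra_simps del: power_Suc mult_Suc_right)
qed

text \<open>By strong induction on the coefficient index: as \<open>N\<close> grows, the corrections
  in \<open>fps_nth_prod_quad_factor\<close> tend to 0, leaving the recurrence of \<open>a\<close>.
  Since \<open>norm q > 1\<close>, the factor \<open>q ^ n - 1\<close> is nonzero for positive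
  \<open>n\<close> and can be divided out.\<close>

lemma tendsto_prod_quad_factor:
  fixes q b d :: complex and a :: "nat \<Rightarrow> complex"
  assumes q: "norm q > 1"
    and a0: "a 0 = 1" and a1: "(q - 1) * a 1 = b"
    and a2: "\<And>n. (q ^ Suc (Suc n) - 1) * a (Suc (Suc n)) = b * a (Suc n) + d * a n"
  shows "(\<lambda>N. fps_nth (\<Prod>i\<in>{1..N}. quad_factor q b d i) n) \<longlonglongrightarrow> a n"
proof (induction n rule: less_induct)
  case (less n)
  let ?p = "\<lambda>N. fps_nth (\<Prod>i\<in>{1..N::nat}. quad_factor q b d i)"
  have q0: "q \<noteq> 0" using q by auto
  have "norm (1 / q) < 1" using q by (simp add: norm_divide divide_less_eq)
  then have "(\<lambda>N. (1 / q) ^ N) \<longlonglongrightarrow> 0" by (rule LIMSEQ_power_zero)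
  then have z: "(\<lambda>N. 1 / q ^ N) \<longlonglongrightarrow> 0" by (simp add: power_one_over)
  have z1: "(\<lambda>N. q ^ n / q ^ Suc N) \<longlonglongrightarrow> 0"
    using tendsto_mult_left[OF LIMSEQ_Suc[OF z], of "q ^ n"] by simp
  have "(\<lambda>N. q ^ n * (1 / q ^ Suc N * (1 / q ^ Suc N))) \<longlonglongrightarrow> q ^ n * (0 * 0)"
    by (intro tendsto_intros LIMSEQ_Suc[OF z])
  moreover have "q ^ n / q ^ (2 * Suc N) = q ^ n * (1 / q ^ Suc N * (1 / q ^ Suc N))" for N
    unfolding mult_2 power_add by (simp del: power_Suc)
  ultimately have z2: "(\<lambda>N. q ^ n / q ^ (2 * Suc N)) \<longlonglongrightarrow> 0"
    by (simp only: mult_zero_right)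
  show ?case
  proof (cases "n = 0")
    case True
    \<comment> \<open>At index 0 the recurrence reads 0 = 0, so the constant term is computed
      directly.\<close>
    have "?p N 0 = 1" for N
      by (induction N) (simp_all add: quad_factor_def)
    then show ?thesis using True a0 by simp
  next
    case False
    have "norm (q ^ n) > 1" using q False by (simp add: norm_power)
    then have qn: "q ^ n - 1 \<noteq> 0" by auto
    have t1: "(\<lambda>N. b * (1 - q ^ n / q ^ Suc N) * ?p N (n - 1)) \<longlonglongrightarrow> b * (1 - 0) * a (n - 1)"
      using False by (intro tendsto_mult tendsto_diff tendsto_const z1 less.IH) simp
    have t2: "(\<lambda>N. d * (1 - q ^ n / q ^ (2 * Suc N)) * ?p N (n - 2)) \<longlonglongrightarrow> d * (1 - 0) * a (n - 2)"
      using False by (intro tendsto_mult tendsto_diff tendsto_const z2 less.IH) simp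
    let ?L = "(if n < 1 then 0 else b * (1 - 0) * a (n - 1)) + (if n < 2 then 0 else d * (1 - 0) * a (n - 2))"
    have "(\<lambda>N. (if n < 1 then 0 else b * (1 - q ^ n / q ^ Suc N) * ?p N (n - 1))
        + (if n < 2 then 0 else d * (1 - q ^ n / q ^ (2 * Suc N)) * ?p N (n - 2))) \<longlonglongrightarrow> ?L"
      using tendsto_add[OF t1 t2] t1 False by (cases "n < 2") (simp_all del: power_Suc mult_Suc_right)
    then have "(\<lambda>N. (q ^ n - 1) * ?p N n / (q ^ n - 1)) \<longlonglongrightarrow> ?L / (q ^ n - 1)"
      unfolding fps_nth_prod_quad_factor[OF q0] using qn by (intro tendsto_divide tendsto_const)
    moreover have "?L = (q ^ n - 1) * a n"
    proof (cases "n = 1")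
      case True
      then show ?thesis using a0 a1 by simp
    next
      case False
      then obtain m where "n = Suc (Suc m)" using \<open>n \<noteq> 0\<close> by (metis One_nat_def not0_implies_Suc)
      then show ?thesis using a2[of m] by simp
    qed
    ultimately show ?thesis using qn by simp
  qed
qed

section \<open>The coefficients of the generating function\<close>

lemma inv_pairs_nonempty: "inv_pairs n \<noteq> {}"
  using inv_pairsI[of "1\<^sub>m n" n "1\<^sub>m n"] by auto

text \<open>The value 1 set by definition at \<open>n = 0\<close> agrees with the quotient, because
  \<open>inv_pairs 0\<close> has a single element, with trace sum 0.\<close>

lemma fps_nth_GL_char_fps:
  fixes lam :: "'a::{finite,field} \<Rightarrow> complex"
  assumes "add_char lam"
  shows "fps_nth (GL_char_fps lam x y) n
    = mat_kloosterman lam x y n / of_nat (card (inv_pairs n :: ('a mat \<times> 'a mat) set))"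
proof (cases "n = 0")
  case True
  then show ?thesis
    using assms by (simp add: GL_char_fps_def inv_pairs_0 mat_kloosterman_0)
next
  case False
  then show ?thesis
    using sum_GL_eq[of "\<lambda>g h. lam (x * mat_trace g + y * mat_trace h)" n]
    by (simp add: GL_char_fps_def card_GL_eq mat_kloosterman_def)
qed

lemma one_less_card_field: "1 < card (UNIV :: 'a::{finite,field} set)"
proof -
  have "card {0 :: 'a, 1} \<le> card (UNIV :: 'a set)" by (rule card_mono) auto
  then show ?thesis by simp
qed

text \<open>The infinite product is understood as the coefficientwise limit of its partial
  products.\<close>

theorem theorem2:
  fixes lam :: "'a::{finite,field} \<Rightarrow> complex" and x y :: 'a
  assumes "add_char lam" and "nontrivial_char lam"
    and "x \<noteq> 0" and "y \<noteq> 0"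
  shows "\<forall>n. (\<lambda>N. fps_nth (\<Prod>i\<in>{1..N}. GL_factor lam x y i) n)
               \<longlonglongrightarrow> fps_nth (GL_char_fps lam x y) n"
proof
  fix n
  let ?q = "card (UNIV :: 'a set)"
  let ?Q = "of_nat ?q :: complex"
  let ?c = "\<lambda>n. of_nat (card (inv_pairs n :: ('a mat \<times> 'a mat) set)) :: complex"
  let ?K = "mat_kloosterman lam x y"
  let ?k = "kloosterman lam x y"
  note q = one_less_card_field[where 'a = 'a]
  have c0: "?c n \<noteq> 0" for n using inv_pairs_nonempty by simp
  have pow: "?q ^ Suc n > 1" for n using q by (intro one_less_power) auto
  have c: "?c (Suc m) = (?Q ^ Suc m - 1) * (?Q ^ m * ?c m)" for m
    using pow[of m] unfolding card_inv_pairs_Suc of_nat_mult by (subst of_nat_diff) (simp_all del: power_Suc)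
  have Q0: "?Q \<noteq> 0" using q by simp
  have Q1: "?Q ^ Suc m - 1 \<noteq> 0" for m
    using pow[of m] by (metis eq_iff_diff_eq_0 less_irrefl of_nat_1 of_nat_eq_iff of_nat_power)
  have factor: "GL_factor lam x y = quad_factor ?Q ?k ?Q"
    by (intro ext) (simp add: GL_factor_def quad_factor_def)
  show "(\<lambda>N. fps_nth (\<Prod>i\<in>{1..N}. GL_factor lam x y i) n) \<longlonglongrightarrow> fps_nth (GL_char_fps lam x y) n"
    unfolding factor
  proof (rule tendsto_prod_quad_factor)
    show "norm ?Q > 1" using q by simp
    show "fps_nth (GL_char_fps lam x y) 0 = 1" by (simp add: GL_char_fps_def)
    show "(?Q - 1) * fps_nth (GL_char_fps lam x y) 1 = ?k"
      unfolding fps_nth_GL_char_fps[OF assms(1)] mat_kloosterman_1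
      using c[of 0] Q1[of 0] by (simp add: inv_pairs_0)
    fix m
    have diff: "of_nat (?q ^ Suc (Suc m) - ?q) = ?Q * (?Q ^ Suc m - 1)"
    proof -
      have "?q \<le> ?q ^ Suc (Suc m)" using pow[of m] q by simp
      then show ?thesis by (simp add: algebra_simps)
    qed
    \<comment> \<open>The factor on the left cancels against the same factor in the order of the
      group of size \<open>m + 2\<close>.\<close>
    have "(?Q ^ Suc (Suc m) - 1) * fps_nth (GL_char_fps lam x y) (Suc (Suc m))
        = ?K (Suc (Suc m)) / (?Q ^ Suc m * ?c (Suc m))"
      unfolding fps_nth_GL_char_fps[OF assms(1)] c[of "Suc m"] using Q1[of "Suc m"] by simp
    also have "\<dots> = ?Q ^ Suc m * ?k * ?K (Suc m) / (?Q ^ Suc m * ?c (Suc m))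
        + ?Q * (?Q ^ Suc m - 1) * ?Q ^ Suc (2 * m) * ?K m / (?Q ^ Suc m * ?c (Suc m))"
      unfolding mat_kloosterman_Suc_Suc[OF assms] diff by (simp add: add_divide_distrib)
    also have "?Q ^ Suc m * ?k * ?K (Suc m) / (?Q ^ Suc m * ?c (Suc m)) = ?k * (?K (Suc m) / ?c (Suc m))"
      using Q0 by simp
    \<comment> \<open>One further step of the order recursion supplies \<open>?Q ^ Suc m - 1\<close>
      and \<open>?Q ^ m\<close> in the denominator, and the powers match because 2m + 1 = (m + 1) +
      m.\<close>
    also have "?Q * (?Q ^ Suc m - 1) * ?Q ^ Suc (2 * m) * ?K m / (?Q ^ Suc m * ?c (Suc m)) = ?Q * (?K m / ?c m)"
    proof -
      have "?Q ^ Suc (2 * m) = ?Q ^ Suc m * ?Q ^ m" by (simp add: mult_2 power_add)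
      then show ?thesis unfolding c[of m] using Q0 Q1[of m] c0[of m] by (simp add: divide_simps del: power_Suc)
    qed
    finally show "(?Q ^ Suc (Suc m) - 1) * fps_nth (GL_char_fps lam x y) (Suc (Suc m))
        = ?k * fps_nth (GL_char_fps lam x y) (Suc m) + ?Q * fps_nth (GL_char_fps lam x y) m"
      unfolding fps_nth_GL_char_fps[OF assms(1)] .
  qed
qed

end
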